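(* Let $p$ be a prime and $n\ge1$. The simplex ${\rm IRS}_\ast(\mathcal{L}_{n,p})$ is a Poulsen simplex.
   Context: $\mathcal{L}_{n,p}=(\mathbb{Z}/p\mathbb{Z})^n\wr\mathbb{Z}=\left(\bigoplus_{\mathbb{Z}}(\mathbb{Z}/p\mathbb{Z})^n\right)\rtimes\mathbb{Z}$. For a countable group $G$, ${\rm Sub}(G)$ is the compact metrizable space of subgroups of $G$ with the topology induced from $\{0,1\}^G$ (pointwise convergence of characteristic functions); $G$ acts on it by conjugation. The perfect kernel $\mathcal{K}(G)$ of ${\rm Sub}(G)$ is its unique perfect subset with countable complement. ${\rm IRS}_\ast(G)$ denotes the set of conjugation-invariant Borel probability measures on ${\rm Sub}(G)$ supported on $\mathcal{K}(G)$, with the weak$^*$ topology; it is a simplex. A Poulsen simplex is a (metrizable) simplex whose extreme points form a dense subset. *)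

theory Defs
  imports "HOL-Probability.Probability" "HOL-Algebra.Group"
begin

text \<open>Elements are pairs (f, k): f i j is the j-th coordinate (j < n) in Z/pZ,
  represented by 0..p-1, of the lamp configuration at position i \<in> Z (finitely
  supported), and k \<in> Z. The generator of Z acts on the direct sum by shifting.\<close>

definition lamp_group :: "nat \<Rightarrow> nat \<Rightarrow> ((int \<Rightarrow> nat \<Rightarrow> int) \<times> int) monoid" where
  "lamp_group n p = \<lparr>
     carrier = {(f, k). (\<forall>i j. 0 \<le> f i j \<and> f i j < int p) \<and> (\<forall>i j. n \<le> j \<longrightarrow> f i j = 0)
                        \<and> finite {i. f i \<noteq> (\<lambda>_. 0)}},
     mult = (\<lambda>(f, k) (g, l). (\<lambda>i j. (f i j + g (i - k) j) mod int p, k + l)),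
     one = (\<lambda>_ _. 0, 0) \<rparr>"

definition Sub :: "('a, 'b) monoid_scheme \<Rightarrow> 'a set set" where
  "Sub G = {H. subgroup H G}"

text \<open>Topology induced from {0,1}^G: generated by the sets {H. g \<in> H} and {H. g \<notin> H}.\<close>
definition sub_topology :: "('a, 'b) monoid_scheme \<Rightarrow> 'a set topology" where
  "sub_topology G = subtopology
     (topology_generated_by ({{H. g \<in> H} | g. g \<in> carrier G} \<union> {{H. g \<notin> H} | g. g \<in> carrier G}))
     (Sub G)"

definition conjug :: "('a, 'b) monoid_scheme \<Rightarrow> 'a \<Rightarrow> 'a set \<Rightarrow> 'a set" where
  "conjug G g H = {g \<otimes>\<^bsub>G\<^esub> h \<otimes>\<^bsub>G\<^esub> inv\<^bsub>G\<^esub> g | h. h \<in> H}"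

definition perfect_in :: "'a topology \<Rightarrow> 'a set \<Rightarrow> bool" where
  "perfect_in T K \<longleftrightarrow> K \<subseteq> topspace T \<and> T derived_set_of K = K"

definition perfect_kernel :: "'a topology \<Rightarrow> 'a set" where
  "perfect_kernel T = (THE K. perfect_in T K \<and> countable (topspace T - K))"

definition borel_measure_of :: "'a topology \<Rightarrow> 'a measure" where
  "borel_measure_of T = sigma (topspace T) {U. openin T U}"

definition IRS_star :: "('a, 'b) monoid_scheme \<Rightarrow> 'a set measure set" where
  "IRS_star G = {\<mu>. sets \<mu> = sets (borel_measure_of (sub_topology G))
      \<and> space \<mu> = Sub G
      \<and> prob_space \<mu>
      \<and> (\<forall>g \<in> carrier G. \<forall>A \<in> sets \<mu>.
            emeasure \<mu> ((conjug G g -` A) \<inter> space \<mu>) = emeasure \<mu> A)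
      \<and> emeasure \<mu> (perfect_kernel (sub_topology G)) = 1}"

definition weak_star_topology :: "'a topology \<Rightarrow> 'a measure set \<Rightarrow> 'a measure topology" where
  "weak_star_topology T S = subtopology
     (topology_generated_by {{\<mu>. integral\<^sup>L \<mu> f \<in> U} | f U. continuous_map T euclideanreal f \<and> open U})
     S"

definition extreme_measures :: "'a measure set \<Rightarrow> 'a measure set" where
  "extreme_measures S = {\<mu> \<in> S. \<forall>\<mu>1 \<in> S. \<forall>\<mu>2 \<in> S. \<forall>t::real. 0 < t \<and> t < 1 \<and>
      (\<forall>A \<in> sets \<mu>. emeasure \<mu> A = ennreal t * emeasure \<mu>1 A + ennreal (1 - t) * emeasure \<mu>2 A)
      \<longrightarrow> \<mu>1 = \<mu>2}"

definition poulsen :: "'a measure topology \<Rightarrow> 'a measure set \<Rightarrow> bool" where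
  "poulsen W S \<longleftrightarrow> W closure_of (extreme_measures S) = topspace W"

end

(*
  Elements of the base A (the direct sum) act trivially by conjugation on subgroups of A, and Z acts
  by translation. A subgroup not contained in A is finitely generated, so there are only countably
  many of these; on the other hand the set of subgroups of A is perfect. Hence it is the perfect
  kernel, and the measures in question are the translation-invariant probability measures on Sub(A).

  Given such a measure mu, continuous functions f and a tolerance, f is approximated by functions of
  the trace of H on a window of radius R. Take N much larger than R and choose finitely many subgroups of
  the block [0, N) whose empirical distribution is close to the law under mu of the trace of H on [0, N).
  Repeat the chosen blocks periodically along Z and let nu be the uniform measure on the finite
  translation orbit of the resulting subgroup. Apart from a proportion 2R/N of positions, a window
  of radius R lies inside one block, so the integrals of f under nu and mu are close. A uniform
  measure on a finite orbit is ergodic, hence extreme.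
*)

theory Submission
  imports Defs
begin

section \<open>The space of subgroups\<close>

text \<open>Every invariant measure is approximated directly, ergodic or not: only finitely many
  subgroups fit into a finite window, so the law of the trace is a finite list of weights, which
  block frequencies realise up to rounding. The blocks have to be glued without disturbing each
  other. The glued subgroup is cut out by conditions on the projections to the blocks, so a window
  inside one block sees that block and nothing else. Finite generation outside A rests on the
  finiteness of the lamps. An element of H with shift k > 0 acts on H \<inter> A as translation by
  k, and the last slices of length k of elements supported in [0, km) increase with m inside a
  finite set, so they stabilise. Uniqueness of the perfect kernel comes from compactness: a nonempty
  perfect subset of a compact Hausdorff space is uncountable. Extremality comes from a rigidity: an
  invariant probability measure carried by a finite part of one orbit gives equal mass to its
  points, so both components of a convex combination are the same measure.\<close>

lemma topspace_sub_topology [simp]: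
  assumes "carrier G \<noteq> {}"
  shows "topspace (sub_topology G) = Sub G"
proof -
  obtain g where "g \<in> carrier G" using assms by blast
  then have "\<Union>({{H. g \<in> H} | g. g \<in> carrier G} \<union> {{H. g \<notin> H} | g. g \<in> carrier G}) = UNIV" by blast
  then show ?thesis by (simp only: sub_topology_def topspace_subtopology topology_generated_by_topspace Int_UNIV_left)
qed

lemma openin_sub_topology_member:
  assumes "g \<in> carrier G"
  shows "openin (sub_topology G) {H \<in> Sub G. g \<in> H}" "openin (sub_topology G) {H \<in> Sub G. g \<notin> H}"
proof -
  let ?B = "{{H. g \<in> H} | g. g \<in> carrier G} \<union> {{H. g \<notin> H} | g. g \<in> carrier G}"
  have "openin (topology_generated_by ?B) {H. g \<in> H}" "openin (topology_generated_by ?B) {H. g \<notin> H}"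
    by (rule topology_generated_by_Basis; use assms in blast)+
  moreover have "{H \<in> Sub G. g \<in> H} = {H. g \<in> H} \<inter> Sub G" "{H \<in> Sub G. g \<notin> H} = {H. g \<notin> H} \<inter> Sub G"
    by auto
  ultimately show "openin (sub_topology G) {H \<in> Sub G. g \<in> H}" "openin (sub_topology G) {H \<in> Sub G. g \<notin> H}"
    by (simp_all only: sub_topology_def openin_subtopology_Int)
qed

lemma openin_sub_topology_cylinder:
  assumes "carrier G \<noteq> {}" "finite F" "F \<subseteq> carrier G"
  shows "openin (sub_topology G) {H' \<in> Sub G. H' \<inter> F = H \<inter> F}"
  using assms(2,3)
proof (induction F rule: finite_induct)
  case empty
  have "{H' \<in> Sub G. H' \<inter> {} = H \<inter> {}} = topspace (sub_topology G)"
    using assms(1) by simp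
  then show ?case by (simp only: openin_topspace)
next
  case (insert g F)
  have "{H' \<in> Sub G. H' \<inter> insert g F = H \<inter> insert g F} =
     (if g \<in> H then {H \<in> Sub G. g \<in> H} else {H \<in> Sub G. g \<notin> H}) \<inter> {H' \<in> Sub G. H' \<inter> F = H \<inter> F}"
    using insert.hyps by (auto split: if_splits)
  then show ?case
    using insert.IH insert.prems openin_sub_topology_member[of g G]
    by (simp only: insert_subset if_split simp_thms openin_Int)
qed

text \<open>Finite intersections of subbasic sets test finitely many elements, so openness becomes a
  statement about finite test sets \<open>F\<close>. The later continuity and perfectness arguments
  work with this form.\<close>

lemma openin_sub_topology:
  assumes "carrier G \<noteq> {}"
  shows "openin (sub_topology G) U \<longleftrightarrow> U \<subseteq> Sub G \<and>
     (\<forall>H\<in>U. \<exists>F. finite F \<and> F \<subseteq> carrier G \<and> (\<forall>H'\<in>Sub G. H' \<inter> F = H \<inter> F \<longrightarrow> H' \<in> U))"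
    (is "?L \<longleftrightarrow> ?R")
proof
  assume ?L
  then have "\<exists>V. openin (topology_generated_by ({{H. g \<in> H} | g. g \<in> carrier G} \<union> {{H. g \<notin> H} | g. g \<in> carrier G})) V
      \<and> U = V \<inter> Sub G"
    by (simp only: sub_topology_def openin_subtopology)
  then obtain V where V: "U = V \<inter> Sub G"
    and gen: "generate_topology_on ({{H. g \<in> H} | g. g \<in> carrier G} \<union> {{H. g \<notin> H} | g. g \<in> carrier G}) V"
    unfolding openin_topology_generated_by_iff by (elim exE conjE)
  \<comment> \<open>The claim ranges over all sets \<open>H'\<close>, not only subgroups: the
    generated topology lives on all sets, and the restriction to \<open>Sub G\<close> comes
    afterwards.\<close>
  have "\<forall>H\<in>V. \<exists>F. finite F \<and> F \<subseteq> carrier G \<and> (\<forall>H'. H' \<inter> F = H \<inter> F \<longrightarrow> H' \<in> V)"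
    using gen
  proof induction
    case (Int a b)
    show ?case
    proof
      fix H assume "H \<in> a \<inter> b"
      then have "H \<in> a" "H \<in> b" by auto
      from bspec[OF Int.IH(1) this(1)] bspec[OF Int.IH(2) this(2)]
      obtain F F' where "finite F" "F \<subseteq> carrier G" "\<forall>H'. H' \<inter> F = H \<inter> F \<longrightarrow> H' \<in> a"
        "finite F'" "F' \<subseteq> carrier G" "\<forall>H'. H' \<inter> F' = H \<inter> F' \<longrightarrow> H' \<in> b"
        by (elim exE conjE)
      then show "\<exists>F. finite F \<and> F \<subseteq> carrier G \<and> (\<forall>H'. H' \<inter> F = H \<inter> F \<longrightarrow> H' \<in> a \<inter> b)"
        by (intro exI[of _ "F \<union> F'"]) blast
    qed
  next
    case (UN K)
    show ?case
    proof
      fix H assume "H \<in> \<Union>K"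
      then obtain k where k: "k \<in> K" "H \<in> k" by blast
      from bspec[OF UN.IH[OF k(1)] k(2)] k(1)
      show "\<exists>F. finite F \<and> F \<subseteq> carrier G \<and> (\<forall>H'. H' \<inter> F = H \<inter> F \<longrightarrow> H' \<in> \<Union>K)" by (meson UnionI)
    qed
  next
    case (Basis s)
    then obtain g where g: "g \<in> carrier G" "s = {H. g \<in> H} \<or> s = {H. g \<notin> H}" by blast
    show ?case
      by (intro ballI exI[of _ "{g}"]) (use g in auto)
  qed simp
  note * = this
  show ?R
  proof (intro conjI ballI)
    fix H assume "H \<in> U"
    then have "H \<in> V" using V by simp
    from bspec[OF * this] obtain F where "finite F" "F \<subseteq> carrier G" "\<forall>H'. H' \<inter> F = H \<inter> F \<longrightarrow> H' \<in> V"
      by (elim exE conjE)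
    then show "\<exists>F. finite F \<and> F \<subseteq> carrier G \<and> (\<forall>H'\<in>Sub G. H' \<inter> F = H \<inter> F \<longrightarrow> H' \<in> U)"
      using V by (intro exI[of _ F]) simp
  qed (simp add: V)
next
  assume R: ?R
  show ?L
  proof (subst openin_subopen, intro ballI)
    fix H assume "H \<in> U"
    from bspec[OF conjunct2[OF R] this]
    obtain F where F: "finite F" "F \<subseteq> carrier G" "\<forall>H'\<in>Sub G. H' \<inter> F = H \<inter> F \<longrightarrow> H' \<in> U" by (elim exE conjE)
    have "H \<in> Sub G" using R \<open>H \<in> U\<close> by (elim conjE) (rule subsetD)
    with F(3) show "\<exists>T. openin (sub_topology G) T \<and> H \<in> T \<and> T \<subseteq> U"
      by (intro exI[of _ "{H' \<in> Sub G. H' \<inter> F = H \<inter> F}"] conjI openin_sub_topology_cylinder assms F(1,2))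
         (simp, simp add: subset_iff)
  qed
qed

section \<open>Compactness of the space of subgroups and uniqueness of the perfect kernel\<close>

lemma closedin_sub_topology_cylinder:
  assumes "carrier G \<noteq> {}" "finite F" "F \<subseteq> carrier G"
  shows "closedin (sub_topology G) {H' \<in> Sub G. H' \<inter> F = H \<inter> F}"
proof -
  have "openin (sub_topology G) (Sub G - {H' \<in> Sub G. H' \<inter> F = H \<inter> F})"
    unfolding openin_sub_topology[OF assms(1)]
    by (intro conjI ballI exI[of _ F]) (use assms in auto)
  then show ?thesis using assms by (auto simp: closedin_def)
qed

lemma Hausdorff_space_sub_topology:
  assumes "carrier G \<noteq> {}"
  shows "Hausdorff_space (sub_topology G)"
  unfolding Hausdorff_space_def
proof (intro allI impI)
  fix H H' assume "H \<in> topspace (sub_topology G) \<and> H' \<in> topspace (sub_topology G) \<and> H \<noteq> H'"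
  then have H: "H \<in> Sub G" "H' \<in> Sub G" "H \<noteq> H'" using assms by auto
  then have sub: "H \<subseteq> carrier G" "H' \<subseteq> carrier G" by (auto simp: Sub_def subgroup_def)
  with H obtain g where g: "g \<in> carrier G" "(g \<in> H) \<noteq> (g \<in> H')" by blast
  have "openin (sub_topology G) {K \<in> Sub G. K \<inter> {g} = H \<inter> {g}}"
    "openin (sub_topology G) {K \<in> Sub G. K \<inter> {g} = H' \<inter> {g}}"
    by (rule openin_sub_topology_cylinder; use assms g in simp)+
  moreover have "disjnt {K \<in> Sub G. K \<inter> {g} = H \<inter> {g}} {K \<in> Sub G. K \<inter> {g} = H' \<inter> {g}}"
    using g(2) by (auto simp: disjnt_def)
  ultimately show "\<exists>U V. openin (sub_topology G) U \<and> openin (sub_topology G) V \<and> H \<in> U \<and> H' \<in> V \<and> disjnt U V"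
    using H(1,2) by (intro exI conjI) (assumption | simp)+
qed

text \<open>By Tychonoff the Boolean product over the carrier is compact. A failure to describe a
  subgroup is witnessed by at most three coordinates (the unit, an inverse, a product), so the
  subgroups correspond to a closed subset, and \<open>\<phi>\<close> carries it continuously onto
  \<open>Sub G\<close>.\<close>

lemma compact_space_sub_topology:
  fixes G (structure)
  assumes "group G"
  shows "compact_space (sub_topology G)"
proof -
  interpret group G by fact
  let ?B = "{{H. g \<in> H} | g. g \<in> carrier G} \<union> {{H. g \<notin> H} | g. g \<in> carrier G}"
  define P where "P = product_topology (\<lambda>_. discrete_topology (UNIV :: bool set)) (carrier G)"
  have tP: "topspace P = (\<Pi>\<^sub>E i\<in>carrier G. UNIV)" by (simp add: P_def)
  define \<phi> where "\<phi> = (\<lambda>f. {g \<in> carrier G. f g})"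
  have comp: "compact_space P" unfolding P_def
    by (simp add: compact_space_product_topology compact_space_discrete_topology)
  have pt: "openin P {f \<in> topspace P. f g = b}" if "g \<in> carrier G" for g b
  proof -
    have "continuous_map P (discrete_topology UNIV) (\<lambda>f. f g)"
      unfolding P_def by (rule continuous_map_product_projection[OF that])
    from openin_continuous_map_preimage[OF this, of "{b}"] show ?thesis by simp
  qed
  have cont: "continuous_map P (topology_generated_by ?B) \<phi>"
    unfolding continuous_on_generated_topo_iff
  proof (intro conjI allI impI)
    fix U assume "U \<in> ?B"
    then obtain g b where g: "g \<in> carrier G" "U = {H. (g \<in> H) = b}" by blast
    then have "\<phi> -` U \<inter> topspace P = {f \<in> topspace P. f g = b}" by (auto simp: \<phi>_def)
    with pt[OF g(1)] show "openin P (\<phi> -` U \<inter> topspace P)" by simp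
  qed auto
  define S where "S = {f \<in> topspace P. \<phi> f \<in> Sub G}"
  have "openin P (topspace P - S)"
  proof (subst openin_subopen, intro ballI)
    fix f assume "f \<in> topspace P - S"
    then have f: "f \<in> topspace P" "\<phi> f \<notin> Sub G" by (auto simp: S_def)
    then have "\<not> (\<phi> f \<subseteq> carrier G \<and> \<one> \<in> \<phi> f \<and> (\<forall>a\<in>\<phi> f. inv a \<in> \<phi> f) \<and> (\<forall>a\<in>\<phi> f. \<forall>b\<in>\<phi> f. a \<otimes> b \<in> \<phi> f))"
      unfolding Sub_def by (auto simp: subgroup_def)
    then consider "\<not> f \<one>" | a where "a \<in> carrier G" "f a" "\<not> f (inv a)"
      | a b where "a \<in> carrier G" "b \<in> carrier G" "f a" "f b" "\<not> f (a \<otimes> b)"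
      by (auto simp: \<phi>_def)
    then show "\<exists>T. openin P T \<and> f \<in> T \<and> T \<subseteq> topspace P - S"
    proof cases
      case 1
      then show ?thesis using f pt[OF one_closed, of False]
        by (intro exI[of _ "{f \<in> topspace P. f \<one> = False}"])
           (auto simp: S_def Sub_def \<phi>_def dest: subgroup.one_closed)
    next
      case (2 a)
      then show ?thesis using f openin_Int[OF pt[of a True] pt[OF inv_closed, of a False]]
        by (intro exI[of _ "{f \<in> topspace P. f a = True} \<inter> {f \<in> topspace P. f (inv a) = False}"])
           (auto simp: S_def Sub_def \<phi>_def dest: subgroup.m_inv_closed)
    next
      case (3 a b)
      then show ?thesis using f openin_Int[OF openin_Int[OF pt[of a True] pt[of b True]] pt[OF m_closed, of a b False]]
        by (intro exI[of _ "({f \<in> topspace P. f a = True} \<inter> {f \<in> topspace P. f b = True})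
                  \<inter> {f \<in> topspace P. f (a \<otimes> b) = False}"])
           (auto simp: S_def Sub_def \<phi>_def dest: subgroup.m_closed)
    qed
  qed
  then have "closedin P S" by (auto simp: closedin_def S_def)
  then have "compactin P S" using comp closedin_compact_space by blast
  then have "compactin (topology_generated_by ?B) (\<phi> ` S)" by (rule image_compactin[OF _ cont])
  moreover have "\<phi> ` S = Sub G"
  proof
    show "Sub G \<subseteq> \<phi> ` S"
    proof
      fix H assume H: "H \<in> Sub G"
      then have "H \<subseteq> carrier G" by (auto simp: Sub_def subgroup_def)
      then have "\<phi> (\<lambda>g\<in>carrier G. g \<in> H) = H" by (auto simp: \<phi>_def)
      with H show "H \<in> \<phi> ` S"
        by (intro image_eqI[of _ _ "\<lambda>g\<in>carrier G. g \<in> H"]) (auto simp: S_def tP)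
    qed
  qed (auto simp: S_def)
  ultimately show ?thesis by (simp add: sub_topology_def compact_space_subtopology)
qed

text \<open>Makes the \<open>THE\<close> in the definition of the perfect kernel well defined. If
  one perfect set were not contained in another with countable complement, a clopen cylinder around
  an escaping point would cut out a nonempty perfect piece inside that complement; in a compact
  Hausdorff space such a piece has at least the cardinality of the reals.\<close>

lemma perfect_kernel_sub_topology:
  fixes G (structure)
  assumes "group G" "perfect_in (sub_topology G) K" "countable (Sub G - K)"
  shows "perfect_kernel (sub_topology G) = K"
proof -
  interpret group G by fact
  let ?T = "sub_topology G"
  have ne: "carrier G \<noteq> {}" by auto
  note top = topspace_sub_topology[OF ne]
  have sub: "K1 \<subseteq> K2" if K1: "perfect_in ?T K1" and K2: "perfect_in ?T K2" "countable (Sub G - K2)" for K1 K2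
  proof (rule ccontr)
    assume "\<not> K1 \<subseteq> K2"
    then obtain H where H: "H \<in> K1" "H \<notin> K2" by blast
    have cl: "closedin ?T K1" "closedin ?T K2" using K1 K2 by (metis perfect_in_def closedin_subset derived_set_subset order_refl)+
    have "H \<in> Sub G" using H K1 by (auto simp: perfect_in_def top)
    have "openin ?T (Sub G - K2)" using cl(2) top by (metis openin_closedin_eq closedin_def)
    then obtain F where F: "finite F" "F \<subseteq> carrier G" "\<forall>H'\<in>Sub G. H' \<inter> F = H \<inter> F \<longrightarrow> H' \<in> Sub G - K2"
      unfolding openin_sub_topology[OF ne] using H \<open>H \<in> Sub G\<close> by blast
    define V where "V = {H' \<in> Sub G. H' \<inter> F = H \<inter> F}"
    have V: "openin ?T V" "closedin ?T V" "V \<subseteq> Sub G - K2" "H \<in> V"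
      using openin_sub_topology_cylinder[OF ne F(1,2), of H] closedin_sub_topology_cylinder[OF ne F(1,2), of H]
        F(3) \<open>H \<in> Sub G\<close> by (auto simp: V_def)
    \<comment> \<open>Both halves of clopen matter: \<open>V\<close> closed keeps the piece closed,
      \<open>V\<close> open keeps it free of isolated points.\<close>
    have "?T derived_set_of (V \<inter> K1) = V \<inter> K1"
    proof
      have "closedin ?T (V \<inter> K1)" using V cl by blast
      then show "?T derived_set_of (V \<inter> K1) \<subseteq> V \<inter> K1" by (meson closedin_subset derived_set_subset)
      show "V \<inter> K1 \<subseteq> ?T derived_set_of (V \<inter> K1)"
        using openin_Int_derived_set_of_subset[OF V(1), of K1] K1 by (simp add: perfect_in_def)
    qed
    moreover have "V \<inter> K1 \<noteq> {}" using V H by blast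
    moreover have "locally_compact_space ?T \<and> Hausdorff_space ?T"
      using compact_space_sub_topology[OF assms(1)] Hausdorff_space_sub_topology[OF ne]
      by (simp add: compact_imp_locally_compact_space)
    ultimately have "(UNIV :: real set) \<lesssim> V \<inter> K1" by (intro lepoll_perfect_set) auto
    moreover have "countable (V \<inter> K1)" by (rule countable_subset[OF _ K2(2)]) (use V in blast)
    ultimately show False using uncountable_UNIV_real countable_lepoll by blast
  qed
  show ?thesis unfolding perfect_kernel_def top
    by (rule the_equality) (use assms sub in blast)+
qed

section \<open>Conjugation as a continuous action on subgroups\<close>

lemma subgroup_conjug:
  fixes G (structure)
  assumes "group G" "subgroup H G" "g \<in> carrier G"
  shows "subgroup (conjug G g H) G"
proof -
  interpret group G by fact
  interpret H: subgroup H G by fact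
  have m: "h \<in> carrier G" if "h \<in> H" for h using that by (rule H.mem_carrier)
  show ?thesis
  proof (rule subgroupI)
    show "conjug G g H \<subseteq> carrier G" using assms m by (auto simp: conjug_def)
    show "conjug G g H \<noteq> {}" unfolding conjug_def using H.one_closed by blast
  next
    fix a assume "a \<in> conjug G g H"
    then obtain h where "h \<in> H" "a = g \<otimes> h \<otimes> inv g" by (auto simp: conjug_def)
    then show "inv a \<in> conjug G g H" unfolding conjug_def
      by (intro CollectI exI[of _ "inv h"]) (use assms m in \<open>simp add: inv_mult_group m_assoc\<close>)
  next
    fix a b assume "a \<in> conjug G g H" "b \<in> conjug G g H"
    then obtain h k where hk: "h \<in> H" "a = g \<otimes> h \<otimes> inv g" "k \<in> H" "b = g \<otimes> k \<otimes> inv g" by (auto simp: conjug_def)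
    have "inv g \<otimes> (g \<otimes> (k \<otimes> inv g)) = k \<otimes> inv g"
      using hk assms m by (simp flip: m_assoc)
    then show "a \<otimes> b \<in> conjug G g H" unfolding conjug_def
      by (intro CollectI exI[of _ "h \<otimes> k"]) (use hk assms m \<open>inv g \<otimes> (g \<otimes> (k \<otimes> inv g)) = k \<otimes> inv g\<close> in \<open>simp add: m_assoc\<close>)
  qed
qed

lemma mem_conjug_iff:
  fixes G (structure)
  assumes "group G" "H \<subseteq> carrier G" "g \<in> carrier G" "x \<in> carrier G"
  shows "x \<in> conjug G g H \<longleftrightarrow> inv\<^bsub>G\<^esub> g \<otimes>\<^bsub>G\<^esub> x \<otimes>\<^bsub>G\<^esub> g \<in> H"
proof -
  interpret group G by fact
  show ?thesis
  proof
    assume "x \<in> conjug G g H"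
    then obtain h where h: "h \<in> H" "x = g \<otimes> h \<otimes> inv g" by (auto simp: conjug_def)
    have "h \<in> carrier G" using h assms by blast
    moreover from this have "inv g \<otimes> (g \<otimes> h) = h" using assms by (simp flip: m_assoc)
    ultimately show "inv g \<otimes> x \<otimes> g \<in> H" using h assms by (simp add: m_assoc)
  next
    assume "inv g \<otimes> x \<otimes> g \<in> H"
    moreover have "g \<otimes> (inv g \<otimes> x \<otimes> g) \<otimes> inv g = (g \<otimes> inv g) \<otimes> x \<otimes> (g \<otimes> inv g)"
      using assms by (simp only: m_assoc m_closed inv_closed)
    ultimately show "x \<in> conjug G g H" using assms unfolding conjug_def
      by (intro CollectI exI[of _ "inv g \<otimes> x \<otimes> g"]) simp
  qed
qed

text \<open>By \<open>mem_conjug_iff\<close> a membership test for the conjugate is a membership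
  test for \<open>H\<close> at a conjugated element, so a finite test set for the image pulls back
  to a finite test set for \<open>H\<close>.\<close>

lemma continuous_map_conjug:
  fixes G (structure)
  assumes "group G" "g \<in> carrier G"
  shows "continuous_map (sub_topology G) (sub_topology G) (conjug G g)"
proof -
  interpret group G by fact
  have ne: "carrier G \<noteq> {}" by auto
  show ?thesis unfolding continuous_map_def
  proof (intro conjI allI impI)
    show "conjug G g \<in> topspace (sub_topology G) \<rightarrow> topspace (sub_topology G)"
      using subgroup_conjug[OF assms(1) _ assms(2)] by (auto simp: topspace_sub_topology[OF ne] Sub_def)
    fix U assume "openin (sub_topology G) U"
    then have U: "U \<subseteq> Sub G" "\<And>H. H \<in> U \<Longrightarrow> \<exists>F. finite F \<and> F \<subseteq> carrier G \<and> (\<forall>H'\<in>Sub G. H' \<inter> F = H \<inter> F \<longrightarrow> H' \<in> U)"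
      unfolding openin_sub_topology[OF ne] by auto
    have "\<exists>F. finite F \<and> F \<subseteq> carrier G \<and> (\<forall>H'\<in>Sub G. H' \<inter> F = H \<inter> F \<longrightarrow> conjug G g H' \<in> U)"
      if H: "H \<in> Sub G" "conjug G g H \<in> U" for H
    proof -
      obtain F where F: "finite F" "F \<subseteq> carrier G" "\<forall>H'\<in>Sub G. H' \<inter> F = conjug G g H \<inter> F \<longrightarrow> H' \<in> U"
        using U(2)[OF H(2)] by blast
      show ?thesis
      proof (intro exI[of _ "(\<lambda>x. inv g \<otimes> x \<otimes> g) ` F"] conjI ballI impI)
        show "(\<lambda>x. inv g \<otimes> x \<otimes> g) ` F \<subseteq> carrier G" using F assms by auto
        fix H' assume H': "H' \<in> Sub G" "H' \<inter> (\<lambda>x. inv g \<otimes> x \<otimes> g) ` F = H \<inter> (\<lambda>x. inv g \<otimes> x \<otimes> g) ` F"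
        have "H \<subseteq> carrier G" "H' \<subseteq> carrier G" using H H' by (auto simp: Sub_def subgroup_def)
        then have "conjug G g H' \<inter> F = conjug G g H \<inter> F"
          using H'(2) F(2) mem_conjug_iff[OF assms(1) _ assms(2)] by blast
        then show "conjug G g H' \<in> U"
          using F(3) subgroup_conjug[OF assms(1) _ assms(2)] H' by (auto simp: Sub_def)
      qed (use F in auto)
    qed
    with subgroup_conjug[OF assms(1) _ assms(2)]
    show "openin (sub_topology G) {x \<in> topspace (sub_topology G). conjug G g x \<in> U}"
      unfolding openin_sub_topology[OF ne] topspace_sub_topology[OF ne] by simp
  qed
qed

text \<open>Reduces weak-star density to the simultaneous approximation of finitely many integrals.
  The topology is given by a subbasis, so the induction unites the test functions of an intersection
  and takes the smaller tolerance.\<close>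

lemma in_weak_star_closure:
  assumes "\<mu> \<in> S" "E \<subseteq> S"
    and approx: "\<And>\<F> e. finite \<F> \<Longrightarrow> (\<And>f. f \<in> \<F> \<Longrightarrow> continuous_map T euclideanreal f) \<Longrightarrow> e > 0 \<Longrightarrow>
      \<exists>\<nu>\<in>E. \<forall>f\<in>\<F>. \<bar>integral\<^sup>L \<nu> f - integral\<^sup>L \<mu> f\<bar> < e"
  shows "\<mu> \<in> weak_star_topology T S closure_of E"
  unfolding in_closure_of
proof (intro conjI allI impI)
  let ?B = "{{\<mu>. integral\<^sup>L \<mu> f \<in> U} | f U. continuous_map T euclideanreal f \<and> open U}"
  \<comment> \<open>The zero function with \<open>U = UNIV\<close> shows that the subbasic sets
    cover all measures, so the topspace is all of \<open>S\<close>.\<close>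
  have "{\<mu>. integral\<^sup>L \<mu> (\<lambda>_. 0) \<in> (UNIV :: real set)} \<in> ?B"
    by (intro CollectI exI[of _ "\<lambda>_. 0"] exI[of _ UNIV]) simp
  then have "\<mu> \<in> \<Union>?B" by (rule UnionI) simp
  then show "\<mu> \<in> topspace (weak_star_topology T S)"
    using assms(1) by (simp add: weak_star_topology_def)
  fix V assume "\<mu> \<in> V \<and> openin (weak_star_topology T S) V"
  then obtain W where W: "generate_topology_on ?B W" "V = W \<inter> S" "\<mu> \<in> W"
    unfolding weak_star_topology_def openin_subtopology openin_topology_generated_by_iff by (elim conjE exE) simp
  have "\<exists>\<F> e. finite \<F> \<and> (\<forall>f\<in>\<F>. continuous_map T euclideanreal f) \<and> e > 0 \<and>
      (\<forall>\<nu>. (\<forall>f\<in>\<F>. \<bar>integral\<^sup>L \<nu> f - integral\<^sup>L \<mu> f\<bar> < e) \<longrightarrow> \<nu> \<in> W)"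
    using W(1,3)
  proof induction
    case (Int a b)
    then obtain \<F> e \<F>' e' where "finite \<F>" "\<forall>f\<in>\<F>. continuous_map T euclideanreal f" "e > 0"
      and 1: "\<forall>\<nu>. (\<forall>f\<in>\<F>. \<bar>integral\<^sup>L \<nu> f - integral\<^sup>L \<mu> f\<bar> < e) \<longrightarrow> \<nu> \<in> a"
      and "finite \<F>'" "\<forall>f\<in>\<F>'. continuous_map T euclideanreal f" "e' > 0"
      and 2: "\<forall>\<nu>. (\<forall>f\<in>\<F>'. \<bar>integral\<^sup>L \<nu> f - integral\<^sup>L \<mu> f\<bar> < e') \<longrightarrow> \<nu> \<in> b"
      by auto
    then show ?case by (intro exI[of _ "\<F> \<union> \<F>'"] exI[of _ "min e e'"]) auto
  next
    case (UN K)
    then obtain k where "k \<in> K" "\<mu> \<in> k" by blast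
    with UN.IH[of k] show ?case by (meson UnionI)
  next
    case (Basis s)
    then obtain f U where s: "s = {\<mu>. integral\<^sup>L \<mu> f \<in> U}" "continuous_map T euclideanreal f" "open U" by blast
    with Basis obtain e where "e > 0" "\<forall>y. dist y (integral\<^sup>L \<mu> f) < e \<longrightarrow> y \<in> U"
      unfolding open_dist by blast
    with s show ?case by (intro exI[of _ "{f}"] exI[of _ e]) (auto simp: dist_real_def)
  qed auto
  then obtain \<F> e where *: "finite \<F>" "\<forall>f\<in>\<F>. continuous_map T euclideanreal f" "e > 0"
      "\<forall>\<nu>. (\<forall>f\<in>\<F>. \<bar>integral\<^sup>L \<nu> f - integral\<^sup>L \<mu> f\<bar> < e) \<longrightarrow> \<nu> \<in> W" by blast
  obtain \<nu> where "\<nu> \<in> E" "\<forall>f\<in>\<F>. \<bar>integral\<^sup>L \<nu> f - integral\<^sup>L \<mu> f\<bar> < e"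
    using approx[of \<F> e] * by auto
  then show "\<exists>y. y \<in> E \<and> y \<in> V" using *(4) W assms(2) by blast
qed

text \<open>Uniform continuity: around each subgroup some cylinder keeps \<open>f\<close> within e/2
  of its central value, finitely many such cylinders cover the space, and the union of their test
  sets works everywhere.\<close>

lemma uniform_approx_sub_topology:
  fixes G (structure)
  assumes "group G" "continuous_map (sub_topology G) euclideanreal f" "e > 0"
  obtains F where "finite F" "F \<subseteq> carrier G"
    "\<And>H H'. H \<in> Sub G \<Longrightarrow> H' \<in> Sub G \<Longrightarrow> H \<inter> F = H' \<inter> F \<Longrightarrow> \<bar>f H - f H'\<bar> < e"
proof -
  interpret group G by fact
  let ?T = "sub_topology G"
  have ne: "carrier G \<noteq> {}" by auto
  note top = topspace_sub_topology[OF ne]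
  have "\<exists>F. finite F \<and> F \<subseteq> carrier G \<and> (\<forall>H'\<in>Sub G. H' \<inter> F = H \<inter> F \<longrightarrow> \<bar>f H' - f H\<bar> < e/2)"
    if "H \<in> Sub G" for H
  proof -
    have "openin ?T {H' \<in> topspace ?T. f H' \<in> ball (f H) (e/2)}"
      using assms(2) by (intro openin_continuous_map_preimage) auto
    moreover have "H \<in> {H' \<in> topspace ?T. f H' \<in> ball (f H) (e/2)}" using that assms(3) by (simp add: top)
    ultimately show ?thesis unfolding openin_sub_topology[OF ne]
      by (fastforce simp: dist_real_def abs_minus_commute)
  qed
  then obtain Fs where Fs: "\<And>H. H \<in> Sub G \<Longrightarrow> finite (Fs H) \<and> Fs H \<subseteq> carrier G \<and>
      (\<forall>H'\<in>Sub G. H' \<inter> Fs H = H \<inter> Fs H \<longrightarrow> \<bar>f H' - f H\<bar> < e/2)" by metis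
  define V where "V H = {H' \<in> Sub G. H' \<inter> Fs H = H \<inter> Fs H}" for H
  have "\<forall>U\<in>V ` Sub G. openin ?T U"
    using openin_sub_topology_cylinder[OF ne] Fs by (simp add: V_def)
  moreover have "topspace ?T \<subseteq> \<Union>(V ` Sub G)" unfolding top by (auto simp: V_def)
  ultimately obtain \<D> where \<D>: "finite \<D>" "\<D> \<subseteq> V ` Sub G" "topspace ?T \<subseteq> \<Union>\<D>"
    using compact_space_sub_topology[OF assms(1)] unfolding compact_space_alt by meson
  obtain D where "D \<subseteq> Sub G" "finite D" "\<D> = V ` D"
    using finite_subset_image[OF \<D>(1,2)] by blast
  with \<D>(3) have D: "finite D" "D \<subseteq> Sub G" "Sub G \<subseteq> \<Union>(V ` D)" by (simp_all only: top)
  show ?thesis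
  proof (rule that[of "\<Union>(Fs ` D)"])
    show "finite (\<Union>(Fs ` D))" "\<Union>(Fs ` D) \<subseteq> carrier G"
      using D(1) Fs[OF subsetD[OF D(2)]] by auto
    fix H H' assume HH: "H \<in> Sub G" "H' \<in> Sub G" "H \<inter> \<Union>(Fs ` D) = H' \<inter> \<Union>(Fs ` D)"
    have "H \<in> \<Union>(V ` D)" using D(3) HH(1) by (rule subsetD)
    then obtain A where A: "A \<in> D" "H \<in> V A" by (elim UN_E)
    then have 1: "H \<inter> Fs A = A \<inter> Fs A" by (simp add: V_def)
    have "H' \<inter> Fs A = H \<inter> Fs A" using HH A(1) by blast
    with 1 have 2: "H' \<inter> Fs A = A \<inter> Fs A" by simp
    have "A \<in> Sub G" using A(1) D(2) by (rule subsetD[rotated])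
    then have 3: "\<forall>H'\<in>Sub G. H' \<inter> Fs A = A \<inter> Fs A \<longrightarrow> \<bar>f H' - f A\<bar> < e/2" using Fs by blast
    have "\<bar>f H - f A\<bar> < e/2" "\<bar>f H' - f A\<bar> < e/2" using 3 1 2 HH(1,2) by blast+
    then show "\<bar>f H - f H'\<bar> < e" by linarith
  qed
qed

section \<open>The perfect kernel of the lamplighter group\<close>

definition lamp_base :: "nat \<Rightarrow> nat \<Rightarrow> ((int \<Rightarrow> nat \<Rightarrow> int) \<times> int) set" where
  "lamp_base n p = {x \<in> carrier (lamp_group n p). snd x = 0}"

text \<open>Half-open intervals let consecutive blocks tile the integers.\<close>

definition window :: "nat \<Rightarrow> nat \<Rightarrow> int \<Rightarrow> int \<Rightarrow> ((int \<Rightarrow> nat \<Rightarrow> int) \<times> int) set" where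
  "window n p a b = {x \<in> lamp_base n p. \<forall>i. i < a \<or> b \<le> i \<longrightarrow> fst x i = (\<lambda>_. 0)}"

definition translate :: "int \<Rightarrow> (int \<Rightarrow> nat \<Rightarrow> int) \<times> int \<Rightarrow> (int \<Rightarrow> nat \<Rightarrow> int) \<times> int" where
  "translate k x = (\<lambda>i. fst x (i - k), snd x)"

text \<open>A coordinate projection of lamp configurations. On the base it is a homomorphism, and
  subgroups are later built from conditions on such projections.\<close>

definition restr :: "int \<Rightarrow> int \<Rightarrow> (int \<Rightarrow> nat \<Rightarrow> int) \<times> int \<Rightarrow> (int \<Rightarrow> nat \<Rightarrow> int) \<times> int" where
  "restr a b x = (\<lambda>i. if a \<le> i \<and> i < b then fst x i else (\<lambda>_. 0), snd x)"

definition base_subgroups :: "nat \<Rightarrow> nat \<Rightarrow> ((int \<Rightarrow> nat \<Rightarrow> int) \<times> int) set set" where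
  "base_subgroups n p = {H \<in> Sub (lamp_group n p). H \<subseteq> lamp_base n p}"

lemma lamp_eqI:
  assumes "\<And>i j. fst x i j = fst y i j" "snd x = snd y"
  shows "(x :: (int \<Rightarrow> nat \<Rightarrow> int) \<times> int) = y"
  using assms by (intro prod_eqI ext)

lemma fst_translate [simp]: "fst (translate k x) i = fst x (i - k)"
  and snd_translate [simp]: "snd (translate k x) = snd x"
  by (simp_all add: translate_def)

lemma fst_restr [simp]: "fst (restr a b x) i = (if a \<le> i \<and> i < b then fst x i else (\<lambda>_. 0))"
  and snd_restr [simp]: "snd (restr a b x) = snd x"
  by (simp_all add: restr_def)

lemma translate_translate [simp]: "translate a (translate b x) = translate (a + b) x"
  by (rule lamp_eqI) (simp_all add: algebra_simps)

lemma translate_0 [simp]: "translate 0 x = x"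
  by (rule lamp_eqI) simp_all

lemma mem_translate_iff: "x \<in> translate k ` H \<longleftrightarrow> translate (- k) x \<in> H"
proof
  assume "translate (- k) x \<in> H"
  then show "x \<in> translate k ` H" by (intro image_eqI[of _ _ "translate (- k) x"]) simp_all
qed auto

lemma translate_image_translate [simp]: "translate a ` translate b ` H = translate (a + b) ` H"
  by (simp add: image_image)

lemma restr_translate: "restr a b (translate k x) = translate k (restr (a - k) (b - k) x)"
  by (rule lamp_eqI) (auto simp: algebra_simps)

locale lamplighter =
  fixes n p :: nat
  assumes n: "n \<ge> 1" and p: "p \<ge> 2"
begin

abbreviation G where "G \<equiv> lamp_group n p"
abbreviation win where "win \<equiv> window n p"
abbreviation base where "base \<equiv> lamp_base n p"

lemma carrier_iff:
  "x \<in> carrier G \<longleftrightarrow> (\<forall>i j. 0 \<le> fst x i j \<and> fst x i j < int p) \<and> (\<forall>i j. n \<le> j \<longrightarrow> fst x i j = 0)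
     \<and> finite {i. fst x i \<noteq> (\<lambda>_. 0)}"
  by (cases x) (simp add: lamp_group_def)

lemma fst_mult [simp]: "fst (x \<otimes>\<^bsub>G\<^esub> y) i j = (fst x i j + fst y (i - snd x) j) mod int p"
  and snd_mult [simp]: "snd (x \<otimes>\<^bsub>G\<^esub> y) = snd x + snd y"
  by (simp_all add: lamp_group_def split: prod.splits)

lemma fst_one [simp]: "fst \<one>\<^bsub>G\<^esub> i j = 0" and snd_one [simp]: "snd \<one>\<^bsub>G\<^esub> = 0"
  by (simp_all add: lamp_group_def)

lemma finite_support_shift:
  assumes "finite {i. f i \<noteq> (\<lambda>_. 0 :: int)}"
  shows "finite {i :: int. f (i - k) \<noteq> (\<lambda>_. 0)}"
proof -
  have "{i. f (i - k) \<noteq> (\<lambda>_. 0)} \<subseteq> (\<lambda>i. i + k) ` {i. f i \<noteq> (\<lambda>_. 0)}"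
  proof
    fix i assume "i \<in> {i. f (i - k) \<noteq> (\<lambda>_. 0)}"
    then show "i \<in> (\<lambda>i. i + k) ` {i. f i \<noteq> (\<lambda>_. 0)}" by (intro image_eqI[of _ _ "i - k"]) simp_all
  qed
  then show ?thesis using assms by (meson finite_imageI finite_subset)
qed

lemma mult_closed:
  assumes "x \<in> carrier G" "y \<in> carrier G"
  shows "x \<otimes>\<^bsub>G\<^esub> y \<in> carrier G"
proof -
  have "{i. fst (x \<otimes>\<^bsub>G\<^esub> y) i \<noteq> (\<lambda>_. 0)} \<subseteq> {i. fst x i \<noteq> (\<lambda>_. 0)} \<union> {i. fst y (i - snd x) \<noteq> (\<lambda>_. 0)}"
    by (auto simp: fun_eq_iff) (metis mod_0)
  moreover have "finite ({i. fst x i \<noteq> (\<lambda>_. 0)} \<union> {i. fst y (i - snd x) \<noteq> (\<lambda>_. 0)})"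
    using assms finite_support_shift[of "fst y" "snd x"] by (simp add: carrier_iff)
  ultimately have "finite {i. fst (x \<otimes>\<^bsub>G\<^esub> y) i \<noteq> (\<lambda>_. 0)}" by (rule finite_subset)
  then show ?thesis using assms p by (simp add: carrier_iff)
qed

definition "linv x = (\<lambda>i j. (- fst x (i + snd x) j) mod int p, - snd (x :: (int \<Rightarrow> nat \<Rightarrow> int) \<times> int))"

lemma linv_closed:
  assumes "x \<in> carrier G"
  shows "linv x \<in> carrier G"
proof -
  have "{i. fst (linv x) i \<noteq> (\<lambda>_. 0)} \<subseteq> {i. fst x (i - (- snd x)) \<noteq> (\<lambda>_. 0)}"
    by (auto simp: fun_eq_iff linv_def) (metis minus_zero mod_0)
  moreover have "finite {i. fst x (i - (- snd x)) \<noteq> (\<lambda>_. 0)}"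
    using assms finite_support_shift[of "fst x" "- snd x"] by (simp add: carrier_iff)
  ultimately have "finite {i. fst (linv x) i \<noteq> (\<lambda>_. 0)}" by (rule finite_subset)
  then show ?thesis using assms p by (simp add: carrier_iff linv_def)
qed

lemma mod_fst: "x \<in> carrier G \<Longrightarrow> fst x i j mod int p = fst x i j"
  by (simp add: carrier_iff)

lemma linv_mult:
  assumes "x \<in> carrier G"
  shows "linv x \<otimes>\<^bsub>G\<^esub> x = \<one>\<^bsub>G\<^esub>"
  by (rule lamp_eqI) (simp_all add: linv_def mod_simps)

lemma group_G: "group G"
proof (rule groupI)
  show "\<one>\<^bsub>G\<^esub> \<in> carrier G" using p by (simp add: carrier_iff fun_eq_iff)
  fix x assume x: "x \<in> carrier G"
  show "\<one>\<^bsub>G\<^esub> \<otimes>\<^bsub>G\<^esub> x = x" by (rule lamp_eqI) (simp_all add: mod_fst[OF x])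
  show "\<exists>y\<in>carrier G. y \<otimes>\<^bsub>G\<^esub> x = \<one>\<^bsub>G\<^esub>" using linv_closed[OF x] linv_mult[OF x] by blast
  fix y z assume "y \<in> carrier G" "z \<in> carrier G"
  show "x \<otimes>\<^bsub>G\<^esub> y \<otimes>\<^bsub>G\<^esub> z = x \<otimes>\<^bsub>G\<^esub> (y \<otimes>\<^bsub>G\<^esub> z)"
    by (rule lamp_eqI) (simp_all add: mod_simps algebra_simps)
qed (rule mult_closed)

sublocale group G by (rule group_G)

lemma inv_eq_linv: "x \<in> carrier G \<Longrightarrow> inv\<^bsub>G\<^esub> x = linv x"
  using inv_equality[OF linv_mult] linv_closed by blast

lemma fst_inv [simp]: "x \<in> carrier G \<Longrightarrow> fst (inv\<^bsub>G\<^esub> x) i j = (- fst x (i + snd x) j) mod int p"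
  and snd_inv [simp]: "x \<in> carrier G \<Longrightarrow> snd (inv\<^bsub>G\<^esub> x) = - snd x"
  by (simp_all add: inv_eq_linv) (simp_all add: linv_def)

lemma carrier_nonempty: "carrier G \<noteq> {}"
  by blast

lemma base_carrier: "x \<in> base \<Longrightarrow> x \<in> carrier G" and snd_base: "x \<in> base \<Longrightarrow> snd x = 0"
  by (simp_all add: lamp_base_def)

lemma conj_base:
  assumes "g \<in> carrier G" "x \<in> base"
  shows "g \<otimes>\<^bsub>G\<^esub> x \<otimes>\<^bsub>G\<^esub> inv\<^bsub>G\<^esub> g = translate (snd g) x"
  using assms
  by (intro lamp_eqI) (simp_all add: base_carrier snd_base mod_simps mod_fst)

lemma conjug_base:
  assumes "g \<in> carrier G" "H \<subseteq> base"
  shows "conjug G g H = translate (snd g) ` H"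
proof -
  have "conjug G g H = (\<lambda>x. g \<otimes>\<^bsub>G\<^esub> x \<otimes>\<^bsub>G\<^esub> inv\<^bsub>G\<^esub> g) ` H" by (auto simp: conjug_def)
  also have "\<dots> = translate (snd g) ` H"
    by (rule image_cong[OF refl]) (use assms conj_base in blast)
  finally show ?thesis .
qed

lemma base_inv_closed: "x \<in> base \<Longrightarrow> inv\<^bsub>G\<^esub> x \<in> base"
  and base_mult_closed: "x \<in> base \<Longrightarrow> y \<in> base \<Longrightarrow> x \<otimes>\<^bsub>G\<^esub> y \<in> base"
  by (simp_all add: lamp_base_def)

lemma one_base: "\<one>\<^bsub>G\<^esub> \<in> base"
  by (simp add: lamp_base_def)

lemma translate_base [simp]: "translate k x \<in> base \<longleftrightarrow> x \<in> base"
proof -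
  have *: "translate k x \<in> base" if "x \<in> base" for k x
    using that finite_support_shift[of "fst x" k] by (simp add: lamp_base_def carrier_iff)
  show ?thesis using *[of x k] *[of "translate k x" "- k"] by auto
qed

lemma window_base: "x \<in> win a b \<Longrightarrow> x \<in> base"
  by (simp add: window_def)

lemma translate_window [simp]: "translate k x \<in> win a b \<longleftrightarrow> x \<in> win (a - k) (b - k)"
proof -
  have "(\<forall>i. i < a \<or> b \<le> i \<longrightarrow> fst x (i - k) = (\<lambda>_. 0)) \<longleftrightarrow> (\<forall>i. i < a - k \<or> b - k \<le> i \<longrightarrow> fst x i = (\<lambda>_. 0))"
    (is "?l \<longleftrightarrow> ?r")
  proof
    assume l: ?l
    show ?r
    proof (intro allI impI)
      fix i assume "i < a - k \<or> b - k \<le> i"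
      then have "i + k < a \<or> b \<le> i + k" by linarith
      from l[rule_format, OF this] show "fst x i = (\<lambda>_. 0)" by simp
    qed
  qed auto
  then show ?thesis by (simp add: window_def)
qed

lemma window_mono: "a' \<le> a \<Longrightarrow> b \<le> b' \<Longrightarrow> x \<in> win a b \<Longrightarrow> x \<in> win a' b'"
  by (auto simp: window_def)

lemma window_fst: "x \<in> win a b \<Longrightarrow> i < a \<or> b \<le> i \<Longrightarrow> fst x i = (\<lambda>_. 0)"
  unfolding window_def by blast

lemma base_subgroupI:
  assumes "H \<subseteq> base" "\<one>\<^bsub>G\<^esub> \<in> H" "\<And>x y. x \<in> H \<Longrightarrow> y \<in> H \<Longrightarrow> x \<otimes>\<^bsub>G\<^esub> y \<in> H" "\<And>x. x \<in> H \<Longrightarrow> inv\<^bsub>G\<^esub> x \<in> H"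
  shows "H \<in> base_subgroups n p"
proof -
  have "subgroup H G" by (rule subgroupI) (use assms base_carrier in blast)+
  then show ?thesis using assms(1) by (simp add: base_subgroups_def Sub_def)
qed

lemma base_subgroupsD:
  assumes "H \<in> base_subgroups n p"
  shows "H \<subseteq> base" "subgroup H G" "\<one>\<^bsub>G\<^esub> \<in> H" "\<And>x y. x \<in> H \<Longrightarrow> y \<in> H \<Longrightarrow> x \<otimes>\<^bsub>G\<^esub> y \<in> H" "\<And>x. x \<in> H \<Longrightarrow> inv\<^bsub>G\<^esub> x \<in> H"
  using assms by (auto simp: base_subgroups_def Sub_def subgroup.one_closed subgroup.m_closed subgroup.m_inv_closed)

lemma window_subgroup: "win a b \<in> base_subgroups n p"
proof (rule base_subgroupI)
  show "win a b \<subseteq> base" by (auto simp: window_base)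
qed (auto simp: window_def one_base base_mult_closed base_inv_closed base_carrier snd_base fun_eq_iff)

lemma subgroup_Int_window: "H \<in> Sub G \<Longrightarrow> H \<inter> win a b \<in> Sub G"
  using base_subgroupsD(2)[OF window_subgroup] by (simp add: Sub_def subgroups_Inter_pair)

lemma base_subgroups_Int_window: "H \<in> Sub G \<Longrightarrow> H \<inter> win a b \<in> base_subgroups n p"
  using subgroup_Int_window[of H a b] base_subgroupsD(1)[OF window_subgroup, of a b]
  by (simp add: base_subgroups_def le_infI2)

lemma base_subgroups_translate:
  assumes "H \<in> base_subgroups n p"
  shows "translate k ` H \<in> base_subgroups n p"
proof -
  have c: "(\<lambda>_ _. 0, k) \<in> carrier G" using p by (simp add: carrier_iff)
  have "translate k ` H = conjug G (\<lambda>_ _. 0, k) H"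
    using conjug_base[OF c base_subgroupsD(1)[OF assms]] by simp
  also have "subgroup \<dots> G" by (rule subgroup_conjug[OF group_G base_subgroupsD(2)[OF assms] c])
  finally have "subgroup (translate k ` H) G" .
  moreover have "translate k ` H \<subseteq> base" using base_subgroupsD(1)[OF assms] by auto
  ultimately show ?thesis by (simp add: base_subgroups_def Sub_def)
qed

lemma restr_window:
  assumes "x \<in> base"
  shows "restr a b x \<in> win a b"
proof -
  have "{i. fst (restr a b x) i \<noteq> (\<lambda>_. 0)} \<subseteq> {i. fst x i \<noteq> (\<lambda>_. 0)}" by auto
  moreover have "finite {i. fst x i \<noteq> (\<lambda>_. 0)}" using assms by (simp add: lamp_base_def carrier_iff)
  ultimately have "finite {i. fst (restr a b x) i \<noteq> (\<lambda>_. 0)}" by (rule finite_subset)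
  then show ?thesis using assms p by (simp add: window_def lamp_base_def carrier_iff)
qed

lemma restr_id: "x \<in> win a b \<Longrightarrow> a' \<le> a \<Longrightarrow> b \<le> b' \<Longrightarrow> restr a' b' x = x"
  by (rule lamp_eqI) (auto simp: window_fst)

lemma restr_mult: "x \<in> base \<Longrightarrow> restr a b (x \<otimes>\<^bsub>G\<^esub> y) = restr a b x \<otimes>\<^bsub>G\<^esub> restr a b y"
  by (rule lamp_eqI) (auto simp: snd_base)

lemma restr_inv: "x \<in> base \<Longrightarrow> restr a b (inv\<^bsub>G\<^esub> x) = inv\<^bsub>G\<^esub> (restr a b x)"
  using restr_window[of x a b, THEN window_base, THEN base_carrier]
  by (intro lamp_eqI) (auto simp: snd_base base_carrier)

text \<open>Projections are homomorphisms on the base, so this is an intersection of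
  \<open>B\<close> with preimages of subgroups. It yields both the perturbation in the perfectness
  proof and the periodic subgroups.\<close>

lemma restr_subgroup:
  assumes "B \<in> base_subgroups n p" "\<And>j. j \<in> J \<Longrightarrow> Y j \<in> base_subgroups n p"
  shows "{x \<in> B. \<forall>j\<in>J. restr (a j) (b j) x \<in> Y j} \<in> base_subgroups n p"
proof (rule base_subgroupI)
  have "restr a b \<one>\<^bsub>G\<^esub> = \<one>\<^bsub>G\<^esub>" for a b by (rule lamp_eqI) auto
  then show "\<one>\<^bsub>G\<^esub> \<in> {x \<in> B. \<forall>j\<in>J. restr (a j) (b j) x \<in> Y j}"
    using assms base_subgroupsD(3) by auto
  show "{x \<in> B. \<forall>j\<in>J. restr (a j) (b j) x \<in> Y j} \<subseteq> base"
    using base_subgroupsD(1)[OF assms(1)] by auto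
next
  fix x y assume xy: "x \<in> {x \<in> B. \<forall>j\<in>J. restr (a j) (b j) x \<in> Y j}" "y \<in> {x \<in> B. \<forall>j\<in>J. restr (a j) (b j) x \<in> Y j}"
  then have "x \<in> base" using base_subgroupsD(1)[OF assms(1)] by auto
  then show "x \<otimes>\<^bsub>G\<^esub> y \<in> {x \<in> B. \<forall>j\<in>J. restr (a j) (b j) x \<in> Y j}"
    using xy base_subgroupsD(4)[OF assms(1)] base_subgroupsD(4)[OF assms(2)] by (simp add: restr_mult)
next
  fix x assume x: "x \<in> {x \<in> B. \<forall>j\<in>J. restr (a j) (b j) x \<in> Y j}"
  then have "x \<in> base" using base_subgroupsD(1)[OF assms(1)] by auto
  then show "inv\<^bsub>G\<^esub> x \<in> {x \<in> B. \<forall>j\<in>J. restr (a j) (b j) x \<in> Y j}"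
    using x base_subgroupsD(5)[OF assms(1)] base_subgroupsD(5)[OF assms(2)] by (simp add: restr_inv)
qed

lemma base_subset_subgroup: "base \<in> base_subgroups n p"
  by (rule base_subgroupI) (auto simp: one_base base_mult_closed base_inv_closed)

text \<open>An element is coded by its values on a finite rectangle of positions and coordinates,
  with finitely many residues as values. This finiteness drives both the finite generation argument
  and the block approximation.\<close>

lemma finite_window: "finite (win a b)"
proof (rule finite_subset)
  let ?I = "{a..<b} \<times> {..<n}"
  let ?h = "\<lambda>g. (\<lambda>i j. if (i, j) \<in> ?I then g (i, j) else 0, 0)"
  show "win a b \<subseteq> ?h ` (PiE ?I (\<lambda>_. {0..<int p}))"
  proof
    fix x assume x: "x \<in> win a b"
    then have xc: "x \<in> carrier G" by (simp add: window_base base_carrier)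
    have "x = ?h (restrict (\<lambda>(i, j). fst x i j) ?I)"
    proof (rule lamp_eqI)
      fix i j
      show "fst x i j = fst (?h (restrict (\<lambda>(i, j). fst x i j) ?I)) i j"
        using window_fst[OF x, of i] xc by (auto simp: carrier_iff)
    qed (use x window_base snd_base in auto)
    moreover have "restrict (\<lambda>(i, j). fst x i j) ?I \<in> PiE ?I (\<lambda>_. {0..<int p})"
      using xc by (auto simp: carrier_iff)
    ultimately show "x \<in> ?h ` (PiE ?I (\<lambda>_. {0..<int p}))" by (rule image_eqI)
  qed
  show "finite (?h ` (PiE ?I (\<lambda>_. {0..<int p})))" by (intro finite_imageI finite_PiE) auto
qed

lemma base_window:
  assumes "x \<in> base"
  obtains m :: nat where "x \<in> win (- int m) (int m)"
proof -
  let ?S = "{i. fst x i \<noteq> (\<lambda>_. 0)}"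
  have fin: "finite ?S" using assms by (simp add: lamp_base_def carrier_iff)
  obtain m :: nat where m: "\<forall>i\<in>?S. nat \<bar>i\<bar> < m"
    using finite_nat_set_iff_bounded[of "(\<lambda>i. nat \<bar>i\<bar>) ` ?S"] fin by auto
  have "x \<in> win (- int m) (int m)"
    unfolding window_def
  proof (intro CollectI conjI allI impI assms)
    fix i assume "i < - int m \<or> int m \<le> i"
    then have "\<not> nat \<bar>i\<bar> < m" by linarith
    with m show "fst x i = (\<lambda>_. 0)" by blast
  qed
  then show ?thesis by (rule that)
qed

lemma finite_subset_window:
  assumes "finite F"
  obtains m :: nat where "F \<inter> base \<subseteq> win (- int m) (int m)"
proof -
  have "\<exists>m::nat. F \<inter> base \<subseteq> win (- int m) (int m)"
    using assms
  proof (induction F rule: finite_induct)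
    case (insert x F)
    then obtain m where m: "F \<inter> base \<subseteq> win (- int m) (int m)" by blast
    show ?case
    proof (cases "x \<in> base")
      case True
      then obtain m' where m': "x \<in> win (- int m') (int m')" by (rule base_window)
      show ?thesis
      proof (intro exI[of _ "max m m'"] subsetI)
        fix y assume y: "y \<in> insert x F \<inter> base"
        then consider "y \<in> win (- int m') (int m')" | "y \<in> win (- int m) (int m)" using m m' by blast
        then show "y \<in> win (- int (max m m')) (int (max m m'))"
          by cases (erule window_mono[rotated 2]; simp)+
      qed
    qed (use m in auto)
  qed auto
  then show ?thesis using that by blast
qed

section \<open>Finite generation of the subgroups outside the base\<close>

lemma countable_carrier: "countable (carrier G)"
proof (rule countable_subset)
  show "carrier G \<subseteq> (\<lambda>(x, k). (fst x, k)) ` ((\<Union>m::nat. win (- int m) (int m)) \<times> UNIV)"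
  proof
    fix x assume "x \<in> carrier G"
    then have "(fst x, 0) \<in> base" by (simp add: lamp_base_def carrier_iff)
    then obtain m where "(fst x, 0) \<in> win (- int m) (int m)" by (rule base_window)
    then show "x \<in> (\<lambda>(x, k). (fst x, k)) ` ((\<Union>m::nat. win (- int m) (int m)) \<times> UNIV)"
      by (intro image_eqI[of _ _ "((fst x, 0), snd x)"]) auto
  qed
  show "countable ((\<lambda>(x, k). (fst x, k)) ` ((\<Union>m::nat. win (- int m) (int m)) \<times> (UNIV :: int set)))"
    by (intro countable_image countable_SIGMA countable_UN) (auto intro: countable_finite finite_window)
qed

text \<open>Since the base is abelian, \<open>y\<close> acts on it by translation through its shift
  even when \<open>y\<close> carries lamps, so \<open>C\<close> need not contain a pure shift.
  Negative multiples come from the inverse of \<open>y\<close>.\<close>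

lemma translate_multiple_mem:
  assumes "subgroup C G" "y \<in> C" "x \<in> C" "x \<in> base"
  shows "translate (snd y * z) x \<in> C"
proof -
  have 1: "translate (snd y) u \<in> C" if "y \<in> C" "u \<in> C" "u \<in> base" for u y
  proof -
    have "y \<in> carrier G" using subgroup.mem_carrier[OF assms(1) that(1)] .
    then have "translate (snd y) u = y \<otimes>\<^bsub>G\<^esub> u \<otimes>\<^bsub>G\<^esub> inv\<^bsub>G\<^esub> y" using conj_base that(3) by simp
    then show ?thesis
      using that assms(1) by (simp add: subgroup.m_closed subgroup.m_inv_closed)
  qed
  show ?thesis
  proof (induction z rule: int_induct[where k = 0])
    case base
    then show ?case using assms by simp
  next
    case (step1 i)
    have "translate (snd y) (translate (snd y * i) x) \<in> C" by (rule 1) (use step1 assms in auto)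
    then show ?case by (simp add: algebra_simps)
  next
    case (step2 i)
    have "inv\<^bsub>G\<^esub> y \<in> C" "y \<in> carrier G"
      using assms(1,2) by (simp_all add: subgroup.m_inv_closed subgroup.mem_carrier)
    then have "translate (snd (inv\<^bsub>G\<^esub> y)) (translate (snd y * i) x) \<in> C" by (intro 1) (use step2 assms in auto)
    then show ?case using \<open>y \<in> carrier G\<close> by (simp add: algebra_simps)
  qed
qed

text \<open>Let \<open>y\<close> have the least positive shift \<open>k\<close> in \<open>H\<close>.
  The last slices of length \<open>k\<close> of base elements of \<open>H\<close> supported in [0,
  km) increase with m, because conjugation by \<open>y\<close> pushes a slice along. They live in a
  finite window, so they stabilise at some \<open>m0\<close>, and \<open>y\<close> together with the
  base elements supported in [0, k m0) suffices. The conclusion quantifies over the subgroups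
  containing \<open>S\<close>, which shows at once that \<open>S\<close> determines
  \<open>H\<close>.\<close>

lemma finite_generation:
  assumes "H \<in> Sub G" "\<not> H \<subseteq> base"
  shows "\<exists>S. finite S \<and> S \<subseteq> H \<and> (\<forall>C\<in>Sub G. S \<subseteq> C \<longrightarrow> H \<subseteq> C)"
proof -
  have H: "subgroup H G" using assms(1) by (simp add: Sub_def)
  interpret H: subgroup H G by (rule H)
  obtain x0 where x0: "x0 \<in> H" "snd x0 \<noteq> 0"
    using assms(2) H.mem_carrier by (auto simp: lamp_base_def)
  have "\<exists>y\<in>H. snd y > 0"
  proof (cases "snd x0 > 0")
    case False
    then have "snd (inv\<^bsub>G\<^esub> x0) > 0" using x0 by simp
    then show ?thesis using x0 by blast
  qed (use x0 in blast)
  then have ex: "\<exists>m. \<exists>y\<in>H. snd y > 0 \<and> nat (snd y) = m" by blast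
  define k where "k = int (LEAST m. \<exists>y\<in>H. snd y > 0 \<and> nat (snd y) = m)"
  obtain y where "y \<in> H" "snd y > 0" "nat (snd y) = (LEAST m. \<exists>y\<in>H. snd y > 0 \<and> nat (snd y) = m)"
    using LeastI_ex[OF ex] by blast
  then have y: "y \<in> H" "snd y = k" "k > 0" unfolding k_def by linarith+
  have least: "k \<le> snd x" if "x \<in> H" "snd x > 0" for x
  proof -
    have "(LEAST m. \<exists>y\<in>H. snd y > 0 \<and> nat (snd y) = m) \<le> nat (snd x)"
      by (rule Least_le) (use that in blast)
    then show ?thesis using that unfolding k_def by linarith
  qed
  define B where "B m = H \<inter> win 0 (k * int m)" for m
  \<comment> \<open>The last slices, translated to the fixed window [-k, 0) so that different
    \<open>m\<close> can be compared.\<close>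
  define W where "W m = (\<lambda>x. restr (- k) 0 (translate (- (k * int m)) x)) ` B m" for m
  have W_sub: "W m \<subseteq> win (- k) 0" for m
  proof
    fix w assume "w \<in> W m"
    then obtain x where x: "x \<in> win 0 (k * int m)" "w = restr (- k) 0 (translate (- (k * int m)) x)"
      by (auto simp: W_def B_def)
    show "w \<in> win (- k) 0" unfolding x(2) by (rule restr_window) (use window_base[OF x(1)] in simp)
  qed
  have W_Suc: "W m \<subseteq> W (Suc m)" for m
  proof
    fix w assume "w \<in> W m"
    then obtain x where x: "x \<in> B m" "w = restr (- k) 0 (translate (- (k * int m)) x)" by (auto simp: W_def)
    have "translate (k * 1) x \<in> H"
      using translate_multiple_mem[OF H y(1), of x 1] x(1) y(2) window_base[of x 0 "k * int m"]
      unfolding B_def by simp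
    moreover have "translate k x \<in> win 0 (k * int (Suc m))"
      using x(1) y(3) unfolding B_def
      by (simp add: algebra_simps) (rule window_mono[of _ 0 "k * int m"]; simp add: algebra_simps)
    ultimately have "translate k x \<in> B (Suc m)" by (simp add: B_def)
    moreover have "w = restr (- k) 0 (translate (- (k * int (Suc m))) (translate k x))"
      using x(2) by (simp add: algebra_simps)
    ultimately show "w \<in> W (Suc m)" unfolding W_def by blast
  qed
  have W_mono: "W m \<subseteq> W m'" if "m \<le> m'" for m m'
    using that W_Suc by (rule lift_Suc_mono_le[of W, rotated])
  have finW: "finite (W m)" for m using W_sub finite_window finite_subset by blast
  \<comment> \<open>The cardinalities are bounded by that of \<open>win (- k) 0\<close>, and an
    increasing chain of finite sets is constant once the maximum is reached.\<close>
  have "\<exists>m0. \<forall>m. card (W m) \<le> card (W m0)"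
    using ex_has_greatest_nat[of "\<lambda>_. True" 0 "\<lambda>m. card (W m)" "Suc (card (win (- k) 0))"]
      card_mono[OF finite_window W_sub] by (auto simp: less_Suc_eq_le)
  then obtain m0 where m0: "\<And>m. card (W m) \<le> card (W m0)" by blast
  have stab: "W m = W m0" if "m \<ge> m0" for m
    using card_seteq[OF finW W_mono[OF that] m0] by simp
  define S where "S = insert y (B m0)"
  have "H \<subseteq> C" if C': "C \<in> Sub G" "S \<subseteq> C" for C
  proof -
    have C: "subgroup C G" using C' by (simp add: Sub_def)
    interpret C: subgroup C G by (rule C)
    have yC: "y \<in> C" using C' by (simp add: S_def)
    have BC: "B m \<subseteq> C" for m
    proof (induction m)
      case 0
      have "B 0 \<subseteq> B m0" unfolding B_def using y(3) window_mono[of 0 0 0 "k * int m0"] by auto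
      then show ?case using C'(2) by (auto simp: S_def)
    next
      case (Suc m)
      show ?case
      proof (cases "Suc m \<le> m0")
        case True
        have "k * int (Suc m) \<le> k * int m0" using True y(3) by (intro mult_left_mono) auto
        then have "B (Suc m) \<subseteq> B m0" unfolding B_def using window_mono[of 0 0 "k * int (Suc m)" "k * int m0"] by blast
        then show ?thesis using C'(2) by (auto simp: S_def)
      next
        case False
        show ?thesis
        proof
          fix x assume x: "x \<in> B (Suc m)"
          then have xH: "x \<in> H" and xw: "x \<in> win 0 (k * int (Suc m))" by (auto simp: B_def)
          have xb: "x \<in> base" by (rule window_base[OF xw])
          define D where "D = k * (int (Suc m) - int m0)"
          have D: "D \<ge> 0" using False y(3) by (simp add: D_def)
          have "restr (- k) 0 (translate (- (k * int (Suc m))) x) \<in> W m0"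
            using x stab[of "Suc m"] False unfolding W_def by fastforce
          then obtain z where z: "z \<in> B m0"
            "restr (- k) 0 (translate (- (k * int (Suc m))) x) = restr (- k) 0 (translate (- (k * int m0)) z)"
            unfolding W_def by blast
          have zw: "z \<in> win 0 (k * int m0)" and zH: "z \<in> H" and zC: "z \<in> C"
            using z(1) C'(2) by (auto simp: B_def S_def)
          \<comment> \<open>Translating \<open>z\<close> by the multiple \<open>D\<close> of
            \<open>k\<close> aligns its last slice with that of \<open>x\<close>. The quotient
            \<open>d\<close> then vanishes on that slice, has support in [0, km), and falls under
            the induction hypothesis.\<close>
          define z' where "z' = translate D z"
          have zb: "z' \<in> base" using window_base[OF zw] by (simp add: z'_def)
          have z'w: "z' \<in> win 0 (k * int (Suc m))"
            unfolding z'_def translate_window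
            by (rule window_mono[OF _ _ zw]) (use D in \<open>auto simp: D_def algebra_simps\<close>)
          have z'H: "z' \<in> H" and z'C: "z' \<in> C"
            using translate_multiple_mem[OF H y(1) zH window_base[OF zw], of "int (Suc m) - int m0"]
              translate_multiple_mem[OF C yC zC window_base[OF zw], of "int (Suc m) - int m0"]
            by (simp_all add: z'_def D_def y(2))
          define d where "d = x \<otimes>\<^bsub>G\<^esub> inv\<^bsub>G\<^esub> z'"
          have fd: "fst d i j = (fst x i j - fst z' i j) mod int p" for i j
            using zb xb by (simp add: d_def base_carrier snd_base mod_simps)
          have "d \<in> base" using xb zb by (simp add: d_def base_mult_closed base_inv_closed)
          moreover have "fst d i = (\<lambda>_. 0)" if i: "i < 0 \<or> k * int m \<le> i" for i
          proof -
            have "fst x i = fst z' i"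
            proof (cases "i < 0 \<or> k * int (Suc m) \<le> i")
              case True
              then show ?thesis using window_fst[OF xw] window_fst[OF z'w] by simp
            next
              case False
              then have ii: "- k \<le> i - k * int (Suc m)" "i - k * int (Suc m) < 0"
                using i by (auto simp: algebra_simps)
              have "fst (translate (- (k * int (Suc m))) x) (i - k * int (Suc m)) =
                fst (translate (- (k * int m0)) z) (i - k * int (Suc m))"
                using arg_cong[OF z(2), of "\<lambda>u. fst u (i - k * int (Suc m))"] ii by (simp del: of_nat_Suc)
              then show ?thesis by (simp add: z'_def D_def algebra_simps)
            qed
            then show ?thesis using fd by (simp add: fun_eq_iff)
          qed
          ultimately have "d \<in> win 0 (k * int m)" by (simp add: window_def)
          moreover have "d \<in> H" using xH z'H by (simp add: d_def H.m_inv_closed H.m_closed)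
          ultimately have "d \<in> C" using Suc by (auto simp: B_def)
          then have "d \<otimes>\<^bsub>G\<^esub> z' \<in> C" using z'C by (rule C.m_closed)
          moreover have "d \<otimes>\<^bsub>G\<^esub> z' = x"
            using xb zb by (simp add: d_def base_carrier m_assoc)
          ultimately show "x \<in> C" by simp
        qed
      qed
    qed
    have base_C: "x \<in> C" if x: "x \<in> H" "x \<in> base" for x
    proof -
      obtain m :: nat where m: "x \<in> win (- int m) (int m)" using base_window[OF x(2)] .
      \<comment> \<open>As k is at least 1, translating [-m, m) by km lands inside [0, 2km).\<close>
      have "int m \<le> k * int m" using y(3) by (simp add: mult_le_cancel_right1)
      then have "translate (k * int m) x \<in> win 0 (k * int (2 * m))"
        unfolding translate_window by (intro window_mono[OF _ _ m]) (simp_all add: algebra_simps)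
      moreover have "translate (k * int m) x \<in> H"
        using translate_multiple_mem[OF H y(1) x, of "int m"] by (simp add: y(2))
      ultimately have "translate (k * int m) x \<in> C" using BC[of "2 * m"] unfolding B_def by blast
      then have "translate (snd y * (- int m)) (translate (k * int m) x) \<in> C"
        by (rule translate_multiple_mem[OF C yC]) (use x in simp)
      then show ?thesis by (simp add: y(2))
    qed
    \<comment> \<open>Division by \<open>y\<close>: minimality of \<open>k\<close> excludes shifts
      strictly between 0 and \<open>k\<close>, so stripping factors \<open>y\<close> ends in the
      base.\<close>
    have nonneg: "x \<in> C" if "x \<in> H" "snd x = int s" for x s
      using that
    proof (induction s arbitrary: x rule: less_induct)
      case (less s)
      show ?case
      proof (cases "s = 0")
        case True
        then show ?thesis using less.prems base_C H.mem_carrier by (simp add: lamp_base_def)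
      next
        case False
        then have "k \<le> int s" using least[of x] less.prems by simp
        define u where "u = inv\<^bsub>G\<^esub> y \<otimes>\<^bsub>G\<^esub> x"
        have "u \<in> H" using y(1) less.prems by (simp add: u_def H.m_inv_closed H.m_closed)
        moreover have "snd u = int (nat (int s - k))"
          using \<open>k \<le> int s\<close> less.prems(2) H.mem_carrier[OF y(1)] by (simp add: u_def y(2))
        moreover have "nat (int s - k) < s" using y(3) \<open>k \<le> int s\<close> by linarith
        ultimately have "u \<in> C" using less.IH by blast
        then have "y \<otimes>\<^bsub>G\<^esub> u \<in> C" using yC by (simp add: C.m_closed)
        moreover have "y \<otimes>\<^bsub>G\<^esub> u = x"
          using H.mem_carrier[OF y(1)] H.mem_carrier[OF less.prems(1)] by (simp add: u_def flip: m_assoc)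
        ultimately show ?thesis by simp
      qed
    qed
    show ?thesis
    proof
      fix x assume x: "x \<in> H"
      show "x \<in> C"
      proof (cases "snd x \<ge> 0")
        case True
        then show ?thesis using nonneg[OF x, of "nat (snd x)"] by simp
      next
        case False
        have "inv\<^bsub>G\<^esub> x \<in> C"
          using nonneg[of "inv\<^bsub>G\<^esub> x" "nat (- snd x)"] False x H.mem_carrier[OF x] by simp
        then have "inv\<^bsub>G\<^esub> (inv\<^bsub>G\<^esub> x) \<in> C" by (rule C.m_inv_closed)
        then show ?thesis using H.mem_carrier[OF x] by simp
      qed
    qed
  qed
  moreover have "finite S" "S \<subseteq> H"
    using y(1) finite_window by (auto simp: S_def B_def)
  ultimately show ?thesis by blast
qed

text \<open>The finite set from \<open>finite_generation\<close> determines its subgroup, so these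
  subgroups inject into the finite subsets of a countable carrier.\<close>

lemma countable_not_base: "countable (Sub G - base_subgroups n p)"
proof -
  obtain S where S: "\<And>H. H \<in> Sub G - base_subgroups n p \<Longrightarrow>
      finite (S H) \<and> S H \<subseteq> H \<and> (\<forall>C\<in>Sub G. S H \<subseteq> C \<longrightarrow> H \<subseteq> C)"
    using finite_generation unfolding base_subgroups_def by simp metis
  have "inj_on S (Sub G - base_subgroups n p)"
  proof (rule inj_onI)
    fix H H' assume "H \<in> Sub G - base_subgroups n p" "H' \<in> Sub G - base_subgroups n p" "S H = S H'"
    then show "H = H'" using S[of H] S[of H'] by (metis DiffD1 subset_antisym)
  qed
  moreover have "S ` (Sub G - base_subgroups n p) \<subseteq> {A. A \<subseteq> carrier G \<and> finite A}"
  proof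
    fix A assume "A \<in> S ` (Sub G - base_subgroups n p)"
    then obtain H where H: "H \<in> Sub G - base_subgroups n p" "A = S H" by (rule imageE)
    have "H \<subseteq> carrier G" using H(1) by (simp add: Sub_def subgroup.subset)
    then show "A \<in> {A. A \<subseteq> carrier G \<and> finite A}" using S[OF H(1)] H(2) by auto
  qed
  then have "countable (S ` (Sub G - base_subgroups n p))"
    using countable_Collect_finite_subset[OF countable_carrier] by (metis (no_types, lifting) Collect_cong conj_commute countable_subset)
  ultimately show ?thesis by (metis countable_image_inj_on)
qed

section \<open>The subgroups of the base form a perfect set\<close>

lemma closedin_base_subgroups: "closedin (sub_topology G) (base_subgroups n p)"
proof -
  have "openin (sub_topology G) (Sub G - base_subgroups n p)"
    unfolding openin_sub_topology[OF carrier_nonempty]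
  proof (intro conjI ballI)
    fix H assume "H \<in> Sub G - base_subgroups n p"
    then obtain x where x: "x \<in> H" "x \<notin> base" "H \<in> Sub G" by (auto simp: base_subgroups_def)
    then have "x \<in> carrier G" by (auto simp: Sub_def subgroup.mem_carrier)
    moreover have "H' \<in> Sub G - base_subgroups n p" if "H' \<in> Sub G" "H' \<inter> {x} = H \<inter> {x}" for H'
      using that x by (auto simp: base_subgroups_def)
    ultimately show "\<exists>F. finite F \<and> F \<subseteq> carrier G \<and> (\<forall>H'\<in>Sub G. H' \<inter> F = H \<inter> F \<longrightarrow> H' \<in> Sub G - base_subgroups n p)"
      by (intro exI[of _ "{x}"]) simp
  qed simp
  then show ?thesis by (auto simp: closedin_def topspace_sub_topology[OF carrier_nonempty] base_subgroups_def)
qed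

text \<open>On subgroups of the base, a neighbourhood contains everything with the same trace on
  some window [-m, m). Two subgroups share the trace of \<open>H\<close> there: \<open>H1\<close>
  has nothing beyond the window, \<open>H2\<close> leaves position m free. They differ from each
  other, so at least one of them differs from \<open>H\<close>, whatever \<open>H\<close>
  is.\<close>

lemma perfect_base_subgroups: "perfect_in (sub_topology G) (base_subgroups n p)"
  unfolding perfect_in_def
proof (intro conjI subset_antisym)
  show sub: "base_subgroups n p \<subseteq> topspace (sub_topology G)"
    using closedin_base_subgroups by (rule closedin_subset)
  show "sub_topology G derived_set_of base_subgroups n p \<subseteq> base_subgroups n p"
    using derived_set_subset[OF sub] closedin_base_subgroups by blast
  show "base_subgroups n p \<subseteq> sub_topology G derived_set_of base_subgroups n p"
  proof
    fix H assume H: "H \<in> base_subgroups n p"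
    show "H \<in> sub_topology G derived_set_of base_subgroups n p"
      unfolding in_derived_set_of
    proof (intro conjI allI impI)
      show "H \<in> topspace (sub_topology G)" using H sub by blast
      fix U assume "H \<in> U \<and> openin (sub_topology G) U"
      then obtain F where F: "finite F" "\<And>H'. H' \<in> Sub G \<Longrightarrow> H' \<inter> F = H \<inter> F \<Longrightarrow> H' \<in> U"
        unfolding openin_sub_topology[OF carrier_nonempty] by meson
      obtain m where m: "F \<inter> base \<subseteq> win (- int m) (int m)" using finite_subset_window[OF F(1)] .
      have nbhd: "H' \<in> U" if H': "H' \<in> base_subgroups n p" "H' \<inter> win (- int m) (int m) = H \<inter> win (- int m) (int m)" for H'
      proof (rule F(2))
        show "H' \<in> Sub G" using H' by (simp add: base_subgroups_def)
        show "H' \<inter> F = H \<inter> F"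
          using H'(2) m base_subgroupsD(1)[OF H] base_subgroupsD(1)[OF H'(1)] by blast
      qed
      define H1 where "H1 = H \<inter> win (- int m) (int m)"
      \<comment> \<open>The one-point index set \<open>{()}\<close> casts a single condition in the
        form of \<open>restr_subgroup\<close>.\<close>
      define H2 where "H2 = {x \<in> win (- int m) (int m + 1). \<forall>j\<in>{()}. restr (- int m) (int m) x \<in> H}"
      have HS: "H \<in> Sub G" using H by (simp add: base_subgroups_def)
      have H1: "H1 \<in> base_subgroups n p" unfolding H1_def by (rule base_subgroups_Int_window[OF HS])
      have H2: "H2 \<in> base_subgroups n p" unfolding H2_def by (rule restr_subgroup[OF window_subgroup H])
      have eq2: "H2 \<inter> win (- int m) (int m) = H \<inter> win (- int m) (int m)"
        unfolding H2_def using restr_id[of _ "- int m" "int m"] window_mono[of "- int m" "- int m" "int m" "int m + 1"] by auto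
      \<comment> \<open>A single lamp at position m, the first position to the right of the
        half-open window [-m, m). The value 1 in coordinate 0 is admissible because
        \<open>p \<ge> 2\<close> and \<open>n \<ge> 1\<close>.\<close>
      define e where "e = (\<lambda>i (j :: nat). if i = int m \<and> j = 0 then 1 else 0 :: int, 0 :: int)"
      have "{i. fst e i \<noteq> (\<lambda>_. 0)} \<subseteq> {int m}" by (auto simp: e_def)
      then have "finite {i. fst e i \<noteq> (\<lambda>_. 0)}" using finite_subset by blast
      then have e: "e \<in> base" using p n by (auto simp: lamp_base_def carrier_iff e_def)
      have "e \<in> win (- int m) (int m + 1)" unfolding window_def using e by (auto simp: e_def)
      moreover have "restr (- int m) (int m) e = \<one>\<^bsub>G\<^esub>" by (rule lamp_eqI) (auto simp: e_def)
      ultimately have "e \<in> H2" using base_subgroupsD(3)[OF H] by (simp add: H2_def)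
      moreover have "e \<notin> H1"
      proof
        assume "e \<in> H1"
        then have "fst e (int m) = (\<lambda>_. 0)" by (intro window_fst[of e "- int m" "int m"]) (auto simp: H1_def)
        then have "fst e (int m) 0 = 0" by simp
        then show False by (simp add: e_def)
      qed
      ultimately consider "H1 \<noteq> H" | "H2 \<noteq> H" by blast
      then show "\<exists>y. y \<noteq> H \<and> y \<in> base_subgroups n p \<and> y \<in> U"
      proof cases
        case 1
        moreover have "H1 \<in> U" by (rule nbhd[OF H1]) (auto simp: H1_def)
        ultimately show ?thesis using H1 by blast
      next
        case 2
        then show ?thesis using H2 nbhd[OF H2 eq2] by blast
      qed
    qed
  qed
qed

lemma perfect_kernel_eq: "perfect_kernel (sub_topology G) = base_subgroups n p"
  by (rule perfect_kernel_sub_topology[OF group_G perfect_base_subgroups countable_not_base])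

end

section \<open>Uniform measures on periodic orbits\<close>

lemma space_borel_measure_of [simp]: "space (borel_measure_of T) = topspace T"
  by (simp add: borel_measure_of_def space_measure_of_conv)

lemma openin_subset_Pow: "{U. openin T U} \<subseteq> Pow (topspace T)"
  using openin_subset by auto

lemma sets_borel_measure_of: "sets (borel_measure_of T) = sigma_sets (topspace T) {U. openin T U}"
  unfolding borel_measure_of_def by (rule sets_measure_of[OF openin_subset_Pow])

lemma openin_borel_sets: "openin T U \<Longrightarrow> U \<in> sets (borel_measure_of T)"
  unfolding sets_borel_measure_of by (rule sigma_sets.Basic) simp

lemma closedin_borel_sets:
  assumes "closedin T C"
  shows "C \<in> sets (borel_measure_of T)"
proof -
  have "topspace T - (topspace T - C) \<in> sets (borel_measure_of T)"
    using assms openin_borel_sets[of T "topspace T - C"] sets.compl_sets[of _ "borel_measure_of T"]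
    by (simp add: closedin_def)
  then show ?thesis using closedin_subset[OF assms] by (simp add: double_diff)
qed

lemma continuous_map_borel_measure_of:
  assumes "continuous_map T T' f"
  shows "f \<in> borel_measure_of T \<rightarrow>\<^sub>M borel_measure_of T'"
proof (rule measurable_sigma_sets[OF sets_borel_measure_of openin_subset_Pow])
  show "f \<in> space (borel_measure_of T) \<rightarrow> topspace T'"
    using continuous_map_funspace[OF assms] by simp
  fix U assume "U \<in> {U. openin T' U}"
  then have "openin T {x \<in> topspace T. f x \<in> U}" using openin_continuous_map_preimage[OF assms] by simp
  moreover have "f -` U \<inter> space (borel_measure_of T) = {x \<in> topspace T. f x \<in> U}" by auto
  ultimately show "f -` U \<inter> space (borel_measure_of T) \<in> sets (borel_measure_of T)"
    by (simp add: openin_borel_sets)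
qed

lemma continuous_map_borel_measurable:
  assumes "continuous_map T euclideanreal f"
  shows "f \<in> borel_measurable (borel_measure_of T)"
proof (rule borel_measurableI)
  fix U :: "real set" assume "open U"
  then have "openin T {x \<in> topspace T. f x \<in> U}" using openin_continuous_map_preimage[OF assms] by simp
  moreover have "f -` U \<inter> space (borel_measure_of T) = {x \<in> topspace T. f x \<in> U}" by auto
  ultimately show "f -` U \<inter> space (borel_measure_of T) \<in> sets (borel_measure_of T)"
    by (simp add: openin_borel_sets)
qed

text \<open>One inclusion is enough: exchanging the two subgroups gives the other.\<close>

lemma conjug_inject:
  fixes G (structure)
  assumes "group G" "g \<in> carrier G" "H \<subseteq> carrier G" "H' \<subseteq> carrier G" "conjug G g H = conjug G g H'"
  shows "H \<subseteq> H'"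
proof
  interpret group G by fact
  fix x assume x: "x \<in> H"
  then have "g \<otimes> x \<otimes> inv g \<in> conjug G g H'" using assms(5) by (auto simp: conjug_def)
  then obtain h where h: "h \<in> H'" "g \<otimes> x \<otimes> inv g = g \<otimes> h \<otimes> inv g" by (auto simp: conjug_def)
  moreover have "x \<in> carrier G" "h \<in> carrier G" using x h assms by auto
  ultimately have "x = h" using assms(2) by simp
  then show "x \<in> H'" using h by simp
qed

lemma periodic_mod:
  fixes Q :: "int \<Rightarrow> 'a"
  assumes "\<And>s. Q (s + M) = Q s"
  shows "Q (s mod M) = Q s"
proof -
  have "Q (s + z * M) = Q s" for s z
  proof (induction z rule: int_induct[where k = 0])
    case (step1 i)
    then show ?case using assms[of "s + i * M"] by (simp add: algebra_simps)
  next
    case (step2 i)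
    then show ?case using assms[of "s + (i - 1) * M"] by (simp add: algebra_simps)
  qed simp
  from this[of "s mod M" "s div M"] show ?thesis by simp
qed

text \<open>Adding k modulo M permutes the residues. This is the source of the invariance of the
  orbit measures.\<close>

lemma card_periodic_shift:
  fixes Q :: "int \<Rightarrow> bool"
  assumes "M > 0" "\<And>s. Q (s + M) = Q s"
  shows "card {s \<in> {0..<M}. Q (s + k)} = card {s \<in> {0..<M}. Q s}"
proof (rule bij_betw_same_card)
  note per = periodic_mod[of Q M, OF assms(2)]
  have m: "((s + k) mod M - k) mod M = s" "((s - k) mod M + k) mod M = s" if "s \<in> {0..<M}" for s
    using that by (simp_all add: mod_simps)
  show "bij_betw (\<lambda>s. (s + k) mod M) {s \<in> {0..<M}. Q (s + k)} {s \<in> {0..<M}. Q s}"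
  proof (rule bij_betw_byWitness[of _ "\<lambda>s. (s - k) mod M"])
    show "(\<lambda>s. (s + k) mod M) ` {s \<in> {0..<M}. Q (s + k)} \<subseteq> {s \<in> {0..<M}. Q s}"
      using assms(1) by (auto simp: per)
    show "(\<lambda>s. (s - k) mod M) ` {s \<in> {0..<M}. Q s} \<subseteq> {s \<in> {0..<M}. Q (s + k)}"
    proof (rule image_subsetI)
      fix s assume s: "s \<in> {s \<in> {0..<M}. Q s}"
      have "Q ((s - k) mod M + k) = Q (((s - k) mod M + k) mod M)" by (rule per[symmetric])
      also have "\<dots> = Q s" using m(2) s by simp
      finally show "(s - k) mod M \<in> {s \<in> {0..<M}. Q (s + k)}" using s assms(1) by simp
    qed
  qed (use m in auto)
qed

section \<open>Invariant measures carried by finite orbits\<close>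

context lamplighter
begin

abbreviation T where "T \<equiv> sub_topology G"
abbreviation \<B> where "\<B> \<equiv> borel_measure_of T"

lemma topspace_T [simp]: "topspace T = Sub G"
  by (rule topspace_sub_topology[OF carrier_nonempty])

text \<open>The pure shift: conjugation by it translates subgroups of the base, which turns
  conjugation invariance into translation invariance.\<close>

definition shifter :: "int \<Rightarrow> (int \<Rightarrow> nat \<Rightarrow> int) \<times> int" where
  "shifter k = (\<lambda>_ _. 0, k)"

lemma shifter_carrier [simp]: "shifter k \<in> carrier G" and snd_shifter [simp]: "snd (shifter k) = k"
  using p by (simp_all add: shifter_def carrier_iff)

lemma conjug_base_subgroup:
  "g \<in> carrier G \<Longrightarrow> H \<in> base_subgroups n p \<Longrightarrow> conjug G g H = translate (snd g) ` H"
  by (rule conjug_base[OF _ base_subgroupsD(1)])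

lemma base_subgroups_Sub: "H \<in> base_subgroups n p \<Longrightarrow> H \<in> Sub G"
  by (simp add: base_subgroups_def)

lemma singleton_sets: "H \<in> Sub G \<Longrightarrow> {H} \<in> sets \<B>"
  using Hausdorff_space_sub_topology[OF carrier_nonempty]
  by (intro closedin_borel_sets closedin_Hausdorff_singleton) auto

lemma conjug_measurable: "g \<in> carrier G \<Longrightarrow> conjug G g \<in> \<B> \<rightarrow>\<^sub>M \<B>"
  by (intro continuous_map_borel_measure_of continuous_map_conjug group_G)

lemma IRS_star_iff:
  "\<mu> \<in> IRS_star G \<longleftrightarrow> sets \<mu> = sets \<B> \<and> space \<mu> = Sub G \<and> prob_space \<mu>
      \<and> (\<forall>g \<in> carrier G. \<forall>A \<in> sets \<mu>. emeasure \<mu> ((conjug G g -` A) \<inter> space \<mu>) = emeasure \<mu> A)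
      \<and> emeasure \<mu> (base_subgroups n p) = 1"
  by (simp add: IRS_star_def perfect_kernel_eq)

text \<open>Conjugation is injective on subgroups, so the preimage of the singleton of the translate
  is exactly \<open>{H}\<close>, and invariance equates the two masses.\<close>

lemma IRS_star_singleton:
  assumes "\<mu> \<in> IRS_star G" "H \<in> base_subgroups n p"
  shows "emeasure \<mu> {translate k ` H} = emeasure \<mu> {H}"
proof -
  have sub: "H' \<subseteq> carrier G" if "H' \<in> Sub G" for H' using that by (auto simp: Sub_def subgroup.mem_carrier)
  have c: "conjug G (shifter k) H = translate k ` H" using assms(2) by (simp add: conjug_base_subgroup)
  have "conjug G (shifter k) -` {translate k ` H} \<inter> Sub G = {H}"
  proof (intro equalityI subsetI)
    fix H' assume "H' \<in> conjug G (shifter k) -` {translate k ` H} \<inter> Sub G"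
    then have H': "H' \<in> Sub G" "conjug G (shifter k) H' = conjug G (shifter k) H" using c by auto
    have "H' = H"
      using conjug_inject[OF group_G shifter_carrier sub sub, OF H'(1) base_subgroups_Sub[OF assms(2)] H'(2)]
        conjug_inject[OF group_G shifter_carrier sub sub, OF base_subgroups_Sub[OF assms(2)] H'(1) H'(2)[symmetric]]
      by (rule subset_antisym)
    then show "H' \<in> {H}" by simp
  qed (use c base_subgroups_Sub[OF assms(2)] in auto)
  moreover have "{translate k ` H} \<in> sets \<mu>"
    using assms base_subgroups_translate[OF assms(2), of k] by (auto simp: IRS_star_iff base_subgroups_Sub singleton_sets)
  ultimately show ?thesis using assms(1) shifter_carrier[of k] unfolding IRS_star_iff by metis
qed

text \<open>All translates of \<open>H\<close> have equal point mass. If nothing is left outside the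
  finite set \<open>Ob\<close>, normalisation fixes that mass as \<open>1 / card Ob\<close>. So at
  most one invariant measure is carried by \<open>Ob\<close>, which is what extremality
  needs.\<close>

lemma IRS_star_finite_orbit:
  assumes \<mu>: "\<mu> \<in> IRS_star G" and H: "H \<in> base_subgroups n p"
    and Ob: "Ob \<subseteq> range (\<lambda>k. translate k ` H)" "finite Ob"
    and null: "emeasure \<mu> (Sub G - Ob) = 0" and A: "A \<in> sets \<B>"
  shows "emeasure \<mu> A = ennreal (card (A \<inter> Ob) / card Ob)"
proof -
  interpret prob_space \<mu> using \<mu> by (simp add: IRS_star_iff)
  have sets: "sets \<mu> = sets \<B>" and space: "space \<mu> = Sub G" using \<mu> by (auto simp: IRS_star_iff)
  have ObS: "{X} \<in> sets \<mu>" if "X \<in> Ob" for X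
    using that Ob(1) base_subgroups_translate[OF H] by (auto simp: sets base_subgroups_Sub singleton_sets)
  have fin: "prob B = card B * prob {H}" if "B \<subseteq> Ob" for B
  proof -
    have "finite B" using that Ob(2) finite_subset by blast
    then have "prob B = (\<Sum>X\<in>B. prob {X})"
      using that ObS by (intro finite_measure_eq_sum_singleton) auto
    also have "\<dots> = (\<Sum>X\<in>B. prob {H})"
    proof (rule sum.cong[OF refl])
      fix X assume "X \<in> B"
      with that Ob(1) have "X \<in> range (\<lambda>k. translate k ` H)" by (meson subsetD)
      then obtain k where "X = translate k ` H" by (rule rangeE)
      then show "prob {X} = prob {H}" using IRS_star_singleton[OF \<mu> H, of k] by (simp add: measure_def)
    qed
    finally show ?thesis by simp
  qed
  have ObM: "Ob \<in> sets \<mu>" using ObS Ob(2) sets.countable[of Ob \<mu>] by (auto intro: countable_finite)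
  have gen: "prob A = prob (A \<inter> Ob)" if "A \<in> sets \<mu>" for A
  proof -
    have "Sub G - Ob \<in> null_sets \<mu>" using null sets.compl_sets[OF ObM] space by (intro null_setsI) auto
    then have "emeasure \<mu> A = emeasure \<mu> (A \<inter> Ob)"
      using that ObM sets.sets_into_space[OF that] space
      by (intro emeasure_eq_AE) (auto intro!: AE_I'[of "Sub G - Ob"])
    then show ?thesis by (simp add: measure_def)
  qed
  have "1 = card Ob * prob {H}"
    using gen[of "space \<mu>"] fin[of Ob] prob_space ObM sets.sets_into_space[OF ObM] by (simp add: Int_absorb1)
  then have "prob {H} = 1 / card Ob" by (metis nonzero_eq_divide_eq mult.commute mult_zero_left zero_neq_one)
  then have "prob A = card (A \<inter> Ob) / card Ob"
    using gen[of A] fin[of "A \<inter> Ob"] A sets by simp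
  then show ?thesis by (simp add: emeasure_eq_measure)
qed

text \<open>When \<open>M\<close> is a period of \<open>H\<close>, possibly not the least one, every
  point of the orbit is hit equally often, so this is the uniform measure on the orbit. The sign in
  \<open>- s\<close> brings position s to the origin.\<close>

definition orbit_measure :: "nat \<Rightarrow> ((int \<Rightarrow> nat \<Rightarrow> int) \<times> int) set \<Rightarrow> ((int \<Rightarrow> nat \<Rightarrow> int) \<times> int) set measure" where
  "orbit_measure M H = distr (measure_pmf (pmf_of_set {0..<int M})) \<B> (\<lambda>s. translate (- s) ` H)"

context
  fixes M :: nat and H
  assumes M: "M > 0" and H: "H \<in> base_subgroups n p" and per: "translate (int M) ` H = H"
begin

lemma orbit_map_measurable: "(\<lambda>s. translate (- s) ` H) \<in> measure_pmf q \<rightarrow>\<^sub>M \<B>"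
  using base_subgroups_translate[OF H] base_subgroups_Sub by auto

lemma emeasure_orbit_measure:
  "A \<in> sets \<B> \<Longrightarrow> emeasure (orbit_measure M H) A = ennreal (card {s \<in> {0..<int M}. translate (- s) ` H \<in> A} / M)"
  unfolding orbit_measure_def using M
  by (subst emeasure_distr[OF orbit_map_measurable])
     (auto simp: emeasure_pmf_of_set Int_def conj_commute)

lemma integral_orbit_measure:
  fixes f :: "((int \<Rightarrow> nat \<Rightarrow> int) \<times> int) set \<Rightarrow> real"
  assumes "f \<in> borel_measurable \<B>"
  shows "integral\<^sup>L (orbit_measure M H) f = (\<Sum>s\<in>{0..<int M}. f (translate (- s) ` H)) / M"
  unfolding orbit_measure_def using M
  by (subst integral_distr[OF orbit_map_measurable assms]) (simp add: integral_pmf_of_set)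

lemma orbit_periodic: "translate (- (s + int M)) ` H = translate (- s) ` H"
proof -
  have "translate (- (s + int M)) ` H = translate (- (s + int M)) ` translate (int M) ` H" using per by simp
  then show ?thesis by (simp only: translate_image_translate) simp
qed

lemma orbit_measure_IRS_star: "orbit_measure M H \<in> IRS_star G"
  unfolding IRS_star_iff
proof (intro conjI ballI)
  show sets: "sets (orbit_measure M H) = sets \<B>" and space: "space (orbit_measure M H) = Sub G"
    by (simp_all add: orbit_measure_def)
  show "prob_space (orbit_measure M H)"
    unfolding orbit_measure_def by (intro prob_space.prob_space_distr orbit_map_measurable prob_space_measure_pmf)
  have K: "base_subgroups n p \<in> sets \<B>" by (rule closedin_borel_sets[OF closedin_base_subgroups])
  have "{s \<in> {0..<int M}. translate (- s) ` H \<in> base_subgroups n p} = {0..<int M}"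
    using base_subgroups_translate[OF H] by blast
  then show "emeasure (orbit_measure M H) (base_subgroups n p) = 1"
    using M by (simp only: emeasure_orbit_measure[OF K]) simp
  fix g A assume g: "g \<in> carrier G" and "A \<in> sets (orbit_measure M H)"
  then have A: "A \<in> sets \<B>" by (simp add: sets)
  have pre: "conjug G g -` A \<inter> Sub G \<in> sets \<B>"
    using measurable_sets[OF conjug_measurable[OF g] A] by simp
  \<comment> \<open>Conjugation by \<open>g\<close> turns index s into index
    \<open>s - snd g\<close>, so passing to the preimage only shifts the index.\<close>
  have "{s \<in> {0..<int M}. translate (- s) ` H \<in> conjug G g -` A \<inter> Sub G} =
    {s \<in> {0..<int M}. translate (- (s + - snd g)) ` H \<in> A}"
    using base_subgroups_translate[OF H] g by (auto simp: conjug_base_subgroup base_subgroups_Sub algebra_simps)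
  moreover have "card {s \<in> {0..<int M}. translate (- (s + - snd g)) ` H \<in> A} = card {s \<in> {0..<int M}. translate (- s) ` H \<in> A}"
    by (rule card_periodic_shift) (use M orbit_periodic in auto)
  ultimately show "emeasure (orbit_measure M H) (conjug G g -` A \<inter> space (orbit_measure M H)) = emeasure (orbit_measure M H) A"
    by (simp add: space emeasure_orbit_measure pre A)
qed

text \<open>Both components have positive weight, so each is null outside the finite orbit;
  \<open>IRS_star_finite_orbit\<close> then determines both in the same way.\<close>

lemma orbit_measure_extreme: "orbit_measure M H \<in> extreme_measures (IRS_star G)"
  unfolding extreme_measures_def
proof (intro CollectI conjI ballI allI impI orbit_measure_IRS_star)
  let ?\<nu> = "orbit_measure M H"
  fix \<mu>1 \<mu>2 and t :: real
  assume \<mu>: "\<mu>1 \<in> IRS_star G" "\<mu>2 \<in> IRS_star G"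
    and t: "0 < t \<and> t < 1 \<and> (\<forall>A\<in>sets ?\<nu>. emeasure ?\<nu> A = ennreal t * emeasure \<mu>1 A + ennreal (1 - t) * emeasure \<mu>2 A)"
  define Ob where "Ob = (\<lambda>s. translate (- s) ` H) ` {0..<int M}"
  have ObS: "Ob \<subseteq> range (\<lambda>k. translate k ` H)" and fin: "finite Ob" by (auto simp: Ob_def)
  have "closedin T Ob"
    using base_subgroups_translate[OF H] base_subgroups_Sub
    by (intro closedin_Hausdorff_finite Hausdorff_space_sub_topology carrier_nonempty fin) (auto simp: Ob_def)
  then have "Ob \<in> sets \<B>" by (rule closedin_borel_sets)
  then have N: "Sub G - Ob \<in> sets \<B>" using sets.compl_sets[of Ob \<B>] by simp
  have "{s \<in> {0..<int M}. translate (- s) ` H \<in> Sub G - Ob} = {}" by (auto simp: Ob_def)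
  then have "emeasure ?\<nu> (Sub G - Ob) = 0" by (simp only: emeasure_orbit_measure[OF N]) simp
  moreover have sets: "sets ?\<nu> = sets \<B>" by (simp add: orbit_measure_def)
  ultimately have "ennreal t * emeasure \<mu>1 (Sub G - Ob) + ennreal (1 - t) * emeasure \<mu>2 (Sub G - Ob) = 0"
    using t N by metis
  then have null: "emeasure \<mu>1 (Sub G - Ob) = 0" "emeasure \<mu>2 (Sub G - Ob) = 0"
    using t by (auto simp: add_eq_0_iff_both_eq_0 ennreal_eq_0_iff)
  show "\<mu>1 = \<mu>2"
  proof (rule measure_eqI)
    show "sets \<mu>1 = sets \<mu>2" using \<mu> by (simp add: IRS_star_iff)
    fix A assume "A \<in> sets \<mu>1"
    then have A: "A \<in> sets \<B>" using \<mu> by (simp add: IRS_star_iff)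
    show "emeasure \<mu>1 A = emeasure \<mu>2 A"
      using IRS_star_finite_orbit[OF \<mu>(1) H ObS fin null(1) A] IRS_star_finite_orbit[OF \<mu>(2) H ObS fin null(2) A]
      by simp
  qed
qed

end

end

section \<open>Periodic approximation\<close>

lemma list_with_counts:
  assumes "finite P"
  obtains xs where "\<And>X. count_list xs X = (if X \<in> P then c X else 0)"
proof -
  obtain xs where xs: "mset xs = (\<Sum>X\<in>P. replicate_mset (c X) X)" using ex_mset by blast
  have "count_list xs X = (if X \<in> P then c X else 0)" for X
  proof -
    have "count_list xs X = count (\<Sum>X\<in>P. replicate_mset (c X) X) X"
      by (simp flip: xs add: count_mset)
    also have "\<dots> = (\<Sum>Y\<in>P. if Y = X then c Y else 0)"
      by (simp add: count_sum count_replicate_mset if_distrib eq_commute cong: if_cong)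
    finally show ?thesis using assms by simp
  qed
  then show ?thesis by (rule that)
qed

text \<open>The numbers \<open>K * w X\<close> are rounded down, and the whole deficit, at most
  \<open>card P\<close>, goes to one point \<open>X0\<close>, so that the counts add up to
  \<open>K\<close>. Each count then errs by at most \<open>card P\<close>, and \<open>K\<close> was
  chosen above \<open>card P / d\<close>. The result is a list because its entries later serve as
  consecutive blocks.\<close>

lemma rational_weights:
  fixes w :: "'a \<Rightarrow> real"
  assumes P: "finite P" "P \<noteq> {}" and w: "\<And>X. X \<in> P \<Longrightarrow> w X \<ge> 0" "sum w P = 1" and d: "d > 0"
  obtains xs where "xs \<noteq> []" "set xs \<subseteq> P" "\<And>X. X \<in> P \<Longrightarrow> \<bar>count_list xs X / length xs - w X\<bar> \<le> d"
proof -
  obtain X0 where X0: "X0 \<in> P" using P by blast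
  obtain K :: nat where K: "K > card P / d" using reals_Archimedean2 by blast
  have K0: "K > 0" using K d by (cases K) (auto simp: divide_less_0_iff)
  define c where "c X = nat \<lfloor>K * w X\<rfloor>" for X
  have c: "real (c X) \<le> K * w X" "K * w X < c X + 1" if "X \<in> P" for X
    using w(1)[OF that] by (auto simp: c_def of_nat_nat) linarith
  have "real (sum c P) \<le> (\<Sum>X\<in>P. K * w X)" using c by (simp add: sum_mono)
  also have "\<dots> = K" using w(2) by (simp flip: sum_distrib_left)
  finally have le: "sum c P \<le> K" by (simp only: of_nat_le_iff)
  have "real K = (\<Sum>X\<in>P. K * w X)" using w(2) by (simp flip: sum_distrib_left)
  also have "\<dots> \<le> (\<Sum>X\<in>P. real (c X) + 1)" using c(2) by (intro sum_mono less_imp_le) (simp add: add.commute)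
  also have "\<dots> = real (sum c P) + card P" by (simp add: sum.distrib)
  finally have left: "real K - real (sum c P) \<le> card P" by simp
  define c' where "c' X = c X + (if X = X0 then K - sum c P else 0)" for X
  have sum_c': "sum c' P = K" using P(1) X0 le by (simp add: c'_def sum.distrib)
  \<comment> \<open>Rounding alone errs by up to 1; this absorbs that error into the bound
    \<open>card P\<close>.\<close>
  have "real (card P) \<ge> 1" using P by (simp add: Suc_le_eq card_gt_0_iff)
  have close: "\<bar>real (c' X) - K * w X\<bar> \<le> card P" if "X \<in> P" for X
  proof (cases "X = X0")
    case True
    then have "real (c' X) = real (c X) + (real K - real (sum c P))"
      using le by (simp add: c'_def of_nat_diff)
    moreover have "real (sum c P) \<le> real K" using le by (simp only: of_nat_le_iff)
    ultimately show ?thesis using c[OF that] left \<open>real (card P) \<ge> 1\<close> by linarith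
  next
    case False
    then have "c' X = c X" by (simp only: c'_def if_False add_0_right)
    then show ?thesis using c[OF that] \<open>real (card P) \<ge> 1\<close> by linarith
  qed
  obtain xs where xs: "\<And>X. count_list xs X = (if X \<in> P then c' X else 0)" by (rule list_with_counts[OF P(1), of c']) blast
  have sub: "set xs \<subseteq> P"
  proof
    fix X assume "X \<in> set xs"
    then have "count_list xs X \<noteq> 0" by (simp add: count_list_0_iff)
    then show "X \<in> P" using xs[of X] by (simp split: if_splits)
  qed
  have "length xs = (\<Sum>X\<in>set xs. count_list xs X)" by (simp add: sum_count_set)
  also have "\<dots> = (\<Sum>X\<in>P. count_list xs X)"
    by (rule sum.mono_neutral_left) (use P(1) sub in \<open>auto simp: count_list_0_iff\<close>)
  also have "\<dots> = K" using xs sum_c' by simp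
  finally have len: "length xs = K" .
  show ?thesis
  proof (rule that)
    show "xs \<noteq> []" using len K0 by auto
    show "set xs \<subseteq> P" by fact
    fix X assume X: "X \<in> P"
    have "count_list xs X / length xs - w X = (real (c' X) - K * w X) / K"
      using K0 X xs[of X] by (simp add: len diff_divide_distrib)
    then have "\<bar>count_list xs X / length xs - w X\<bar> = \<bar>real (c' X) - K * w X\<bar> / K"
      by (simp add: abs_divide)
    also have "\<dots> \<le> card P / K" using close[OF X] by (simp add: divide_right_mono)
    also have "\<dots> \<le> d" using K K0 d by (simp add: field_simps)
    finally show "\<bar>count_list xs X / length xs - w X\<bar> \<le> d" .
  qed
qed

lemma sum_nth_eq_sum_count:
  fixes h :: "'a \<Rightarrow> real"
  assumes "finite P" "set xs \<subseteq> P"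
  shows "(\<Sum>j<length xs. h (xs ! j)) = (\<Sum>X\<in>P. count_list xs X * h X)"
proof -
  have "(\<Sum>j<length xs. h (xs ! j)) = sum_list (map h xs)"
    by (simp add: sum_list_sum_nth atLeast0LessThan)
  also have "\<dots> = (\<Sum>X\<in>P. count_list xs X * h X)"
    using assms(2)
  proof (induction xs)
    case (Cons x xs)
    have "(\<Sum>X\<in>P. count_list (x # xs) X * h X) = (\<Sum>X\<in>P. count_list xs X * h X + (if X = x then h X else 0))"
      by (intro sum.cong) (auto simp: algebra_simps)
    then show ?case using Cons assms(1) by (simp add: sum.distrib)
  qed simp
  finally show ?thesis .
qed

text \<open>Write s = jN + r. The offset r is made the outer index because, for a fixed offset, the
  inner sum over j will be an empirical sum of one function of the block.\<close>

lemma sum_int_blocks: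
  fixes f :: "int \<Rightarrow> real"
  shows "(\<Sum>s\<in>{0..<int (K * N)}. f s) = (\<Sum>r<N. \<Sum>j<K. f (int j * int N + int r))"
proof -
  have "(\<Sum>s\<in>{0..<int (K * N)}. f s) = (\<Sum>s<K * N. f (int s))"
    by (rule sum.reindex_bij_witness[of _ int nat]) (auto simp: nat_less_iff simp del: of_nat_mult)
  also have "\<dots> = (\<Sum>j<K. \<Sum>s\<in>{j * N..<j * N + N}. f (int s))" by (rule sum.nat_group[symmetric])
  also have "\<dots> = (\<Sum>j<K. \<Sum>r<N. f (int j * int N + int r))"
  proof (rule sum.cong[OF refl])
    fix j
    show "(\<Sum>s\<in>{j * N..<j * N + N}. f (int s)) = (\<Sum>r<N. f (int j * int N + int r))"
      by (rule sum.reindex_bij_witness[of _ "\<lambda>r. j * N + r" "\<lambda>s. s - j * N"]) auto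
  qed
  also have "\<dots> = (\<Sum>r<N. \<Sum>j<K. f (int j * int N + int r))" by (rule sum.swap)
  finally show ?thesis .
qed

text \<open>At most \<open>2 * R\<close> offsets are too close to an end of the block; they are
  charged the crude bound \<open>b\<close>, all others the fine bound \<open>a\<close>.\<close>

lemma average_mostly_close:
  fixes D :: "nat \<Rightarrow> real"
  assumes good: "\<And>r. r < N \<Longrightarrow> R \<le> r \<Longrightarrow> r + R < N \<Longrightarrow> \<bar>D r - I\<bar> \<le> a"
    and bad: "\<And>r. r < N \<Longrightarrow> \<bar>D r - I\<bar> \<le> b" and ab: "a \<ge> 0" "b \<ge> 0" and N: "N > 0"
  shows "\<bar>(\<Sum>r<N. D r) / N - I\<bar> \<le> a + b * (2 * real R) / N"
proof -
  let ?B = "{r. r < N \<and> (r < R \<or> N \<le> r + R)}"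
  have "card ?B \<le> card ({..<R} \<union> {N - R..<N})" by (intro card_mono) auto
  also have "\<dots> \<le> R + (N - (N - R))" using card_Un_le[of "{..<R}" "{N - R..<N}"] by simp
  finally have card: "card ?B \<le> 2 * R" by simp
  have "\<bar>(\<Sum>r<N. D r) - N * I\<bar> = \<bar>\<Sum>r<N. D r - I\<bar>" by (simp add: sum_subtractf)
  also have "\<dots> \<le> (\<Sum>r<N. \<bar>D r - I\<bar>)" by (rule sum_abs)
  also have "\<dots> \<le> (\<Sum>r<N. a + (if r \<in> ?B then b else 0))"
  proof (rule sum_mono)
    fix r assume r: "r \<in> {..<N}"
    show "\<bar>D r - I\<bar> \<le> a + (if r \<in> ?B then b else 0)"
      using good[of r] bad[of r] ab r by (cases "r \<in> ?B") auto
  qed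
  also have "\<dots> = N * a + card ?B * b"
  proof -
    have "(\<Sum>r<N. if r \<in> ?B then b else 0) = (\<Sum>r\<in>?B. b)"
      by (rule sum.mono_neutral_cong_right) auto
    then show ?thesis by (simp add: sum.distrib)
  qed
  also have "\<dots> \<le> N * a + (2 * real R) * b"
  proof -
    have "real (card ?B) \<le> 2 * real R" using of_nat_mono[OF card, where ?'a = real] by simp
    then show ?thesis using ab by (intro add_left_mono mult_right_mono) simp_all
  qed
  finally have *: "\<bar>(\<Sum>r<N. D r) - N * I\<bar> \<le> N * a + (2 * real R) * b" .
  have "(\<Sum>r<N. D r) / N - I = ((\<Sum>r<N. D r) - N * I) / N"
    using N by (simp add: diff_divide_distrib)
  then have "\<bar>(\<Sum>r<N. D r) / N - I\<bar> = \<bar>(\<Sum>r<N. D r) - N * I\<bar> / N"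
    by (simp add: abs_divide)
  also have "\<dots> \<le> (N * a + (2 * real R) * b) / N" using * by (rule divide_right_mono) simp
  also have "\<dots> = a + b * (2 * real R) / N" using N by (simp add: add_divide_distrib mult.commute)
  finally show ?thesis .
qed

section \<open>Periodic concatenation of block subgroups\<close>

context lamplighter
begin

text \<open>For N > 0 and \<open>Y j\<close> inside \<open>win 0 (int N)\<close> this is the
  internal direct sum of the copies of \<open>Y j\<close> placed in the blocks [jN, jN + N). Stating
  it through projections makes it an instance of \<open>restr_subgroup\<close>.\<close>

definition periodic_concat :: "nat \<Rightarrow> (int \<Rightarrow> ((int \<Rightarrow> nat \<Rightarrow> int) \<times> int) set) \<Rightarrow> ((int \<Rightarrow> nat \<Rightarrow> int) \<times> int) set" where
  "periodic_concat N Y = {x \<in> base. \<forall>j\<in>UNIV. restr (j * int N) (j * int N + int N) x \<in> translate (j * int N) ` Y j}"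

lemma periodic_concat_subgroup:
  "(\<And>j. Y j \<in> base_subgroups n p) \<Longrightarrow> periodic_concat N Y \<in> base_subgroups n p"
  unfolding periodic_concat_def
  by (rule restr_subgroup[OF base_subset_subgroup]) (rule base_subgroups_translate)

text \<open>Translation by KN carries block j to block j + K, so it only reindexes the family of
  conditions.\<close>

lemma periodic_concat_periodic:
  assumes "\<And>j. Y (j + int K) = Y j"
  shows "translate (int (K * N)) ` periodic_concat N Y = periodic_concat N Y"
proof (rule Set.set_eqI)
  fix x
  let ?P = "\<lambda>j. restr (j * int N) (j * int N + int N) x \<in> translate (j * int N) ` Y j"
  have eq: "restr (j * int N) (j * int N + int N) (translate (- int (K * N)) x) \<in> translate (j * int N) ` Y j
      \<longleftrightarrow> ?P (j + int K)" for j
    by (simp add: restr_translate mem_translate_iff[of _ _ "Y _"] assms algebra_simps)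
  have "(\<forall>j. ?P (j + int K)) \<longleftrightarrow> (\<forall>j. ?P j)" by (metis diff_add_cancel)
  then show "x \<in> translate (int (K * N)) ` periodic_concat N Y \<longleftrightarrow> x \<in> periodic_concat N Y"
    unfolding mem_translate_iff[of x] periodic_concat_def by (simp add: eq del: of_nat_mult)
qed

text \<open>The bounds on \<open>r\<close> place the window around position jN + r inside block j.
  An element supported there has trivial projections to the other blocks, where the conditions hold
  because subgroups contain the unit; only the condition from \<open>Y j\<close> survives.\<close>

lemma periodic_concat_window:
  assumes Y: "\<And>j. Y j \<in> base_subgroups n p" and r: "R \<le> r" "r + R < N"
  shows "translate (- (j * int N + int r)) ` periodic_concat N Y \<inter> win (- int R) (int R + 1)
    = translate (- int r) ` Y j \<inter> win (- int R) (int R + 1)"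
proof -
  have "x \<in> translate (- (j * int N + int r)) ` periodic_concat N Y \<longleftrightarrow> x \<in> translate (- int r) ` Y j"
    if x: "x \<in> win (- int R) (int R + 1)" for x
  proof -
    let ?z = "translate (j * int N + int r) x"
    have z: "?z \<in> win (j * int N) (j * int N + int N)"
      unfolding translate_window by (rule window_mono[OF _ _ x]) (use r in linarith)+
    have zb: "?z \<in> base" by (rule window_base[OF z])
    have same: "restr (j * int N) (j * int N + int N) ?z = ?z" by (rule restr_id[OF z]) simp_all
    have other: "restr (i * int N) (i * int N + int N) ?z \<in> translate (i * int N) ` Y i" if "i \<noteq> j" for i
    proof -
      have far: "i * int N + int N \<le> j * int N \<or> j * int N + int N \<le> i * int N"
      proof (cases "i < j")
        case True
        then have "(i + 1) * int N \<le> j * int N" by (intro mult_right_mono) auto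
        then show ?thesis by (simp add: algebra_simps)
      next
        case False
        then have "(j + 1) * int N \<le> i * int N" using that by (intro mult_right_mono) auto
        then show ?thesis by (simp add: algebra_simps)
      qed
      have "restr (i * int N) (i * int N + int N) ?z = \<one>\<^bsub>G\<^esub>"
      proof (rule lamp_eqI)
        fix l q
        have "i * int N \<le> l \<and> l < i * int N + int N \<Longrightarrow> fst ?z l = (\<lambda>_. 0)"
          using far by (intro window_fst[OF z]) linarith
        then show "fst (restr (i * int N) (i * int N + int N) ?z) l q = fst \<one>\<^bsub>G\<^esub> l q"
          by (auto simp del: fst_translate)
      qed (use snd_base[OF zb] in simp)
      then show ?thesis using base_subgroupsD(3)[OF base_subgroups_translate[OF Y]] by simp
    qed
    have "x \<in> translate (- (j * int N + int r)) ` periodic_concat N Y \<longleftrightarrow> ?z \<in> periodic_concat N Y"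
      by (simp add: mem_translate_iff add.commute)
    also have "\<dots> \<longleftrightarrow> (\<forall>i. restr (i * int N) (i * int N + int N) ?z \<in> translate (i * int N) ` Y i)"
      using zb by (simp add: periodic_concat_def)
    also have "\<dots> \<longleftrightarrow> restr (j * int N) (j * int N + int N) ?z \<in> translate (j * int N) ` Y j"
      using other by metis
    also have "\<dots> \<longleftrightarrow> ?z \<in> translate (j * int N) ` Y j" by (simp only: same)
    also have "\<dots> \<longleftrightarrow> x \<in> translate (- int r) ` Y j" by (simp add: mem_translate_iff)
    finally show ?thesis .
  qed
  then show ?thesis by blast
qed

text \<open>The same test set works before and after cutting to the window. This makes the truncated
  test functions continuous, hence measurable and integrable.\<close>

lemma continuous_map_Int_window: "continuous_map T T (\<lambda>H. H \<inter> win a b)"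
  unfolding continuous_map_def
proof (intro conjI allI impI)
  show "(\<lambda>H. H \<inter> win a b) \<in> topspace T \<rightarrow> topspace T" by (simp add: subgroup_Int_window)
  fix U assume "openin T U"
  then have U: "\<And>H. H \<in> U \<Longrightarrow> \<exists>F. finite F \<and> F \<subseteq> carrier G \<and> (\<forall>H'\<in>Sub G. H' \<inter> F = H \<inter> F \<longrightarrow> H' \<in> U)"
    unfolding openin_sub_topology[OF carrier_nonempty] by simp
  show "openin T {H \<in> topspace T. H \<inter> win a b \<in> U}"
    unfolding openin_sub_topology[OF carrier_nonempty]
  proof (intro conjI ballI)
    fix H assume "H \<in> {H \<in> topspace T. H \<inter> win a b \<in> U}"
    then obtain F where F: "finite F" "F \<subseteq> carrier G" "\<forall>H'\<in>Sub G. H' \<inter> F = (H \<inter> win a b) \<inter> F \<longrightarrow> H' \<in> U"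
      using U[of "H \<inter> win a b"] by auto
    have "H' \<inter> win a b \<in> U" if "H' \<in> Sub G" "H' \<inter> F = H \<inter> F" for H'
    proof -
      have "(H' \<inter> win a b) \<inter> F = (H \<inter> win a b) \<inter> F" using that(2) by blast
      then show ?thesis using F(3) subgroup_Int_window[OF that(1)] by simp
    qed
    then show "\<exists>F. finite F \<and> F \<subseteq> carrier G \<and>
        (\<forall>H'\<in>Sub G. H' \<inter> F = H \<inter> F \<longrightarrow> H' \<in> {H \<in> topspace T. H \<inter> win a b \<in> U})"
      using F by (intro exI[of _ F]) simp
  qed auto
qed

lemma integral_conjug:
  fixes f :: "((int \<Rightarrow> nat \<Rightarrow> int) \<times> int) set \<Rightarrow> real"
  assumes \<mu>: "\<mu> \<in> IRS_star G" and g: "g \<in> carrier G" and f: "f \<in> borel_measurable \<B>"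
  shows "(\<integral>H. f (conjug G g H) \<partial>\<mu>) = integral\<^sup>L \<mu> f"
proof -
  have sets: "sets \<mu> = sets \<B>" using \<mu> by (simp add: IRS_star_iff)
  have m: "conjug G g \<in> \<mu> \<rightarrow>\<^sub>M \<mu>"
    using conjug_measurable[OF g] measurable_cong_sets[OF sets sets] by blast
  have "distr \<mu> \<mu> (conjug G g) = \<mu>"
  proof (rule measure_eqI)
    fix A assume "A \<in> sets (distr \<mu> \<mu> (conjug G g))"
    then have A: "A \<in> sets \<mu>" by simp
    then show "emeasure (distr \<mu> \<mu> (conjug G g)) A = emeasure \<mu> A"
      using \<mu> g unfolding emeasure_distr[OF m A] IRS_star_iff by blast
  qed simp
  moreover have "integral\<^sup>L (distr \<mu> \<mu> (conjug G g)) f = (\<integral>H. f (conjug G g H) \<partial>\<mu>)"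
    by (rule integral_distr[OF m]) (use f measurable_cong_sets[OF sets refl] in blast)
  ultimately show ?thesis by simp
qed

section \<open>The law of the trace on a block\<close>

lemma AE_base_subgroups:
  assumes "\<mu> \<in> IRS_star G"
  shows "AE H in \<mu>. H \<in> base_subgroups n p"
proof -
  interpret prob_space \<mu> using assms by (simp add: IRS_star_iff)
  have "prob (base_subgroups n p) = 1" using assms by (simp add: IRS_star_iff measure_def)
  then show ?thesis by (rule AE_prob_1)
qed

definition block_subgroups :: "nat \<Rightarrow> ((int \<Rightarrow> nat \<Rightarrow> int) \<times> int) set set" where
  "block_subgroups N = {X \<in> base_subgroups n p. X \<subseteq> win 0 (int N)}"

definition block_law :: "((int \<Rightarrow> nat \<Rightarrow> int) \<times> int) set measure \<Rightarrow> nat \<Rightarrow> ((int \<Rightarrow> nat \<Rightarrow> int) \<times> int) set \<Rightarrow> real" where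
  "block_law \<mu> N X = measure \<mu> {H \<in> Sub G. H \<inter> win 0 (int N) = X}"

lemma finite_block_subgroups: "finite (block_subgroups N)"
  by (rule finite_subset[of _ "Pow (win 0 (int N))"]) (auto simp: block_subgroups_def finite_window)

lemma block_subgroups_nonempty: "block_subgroups N \<noteq> {}"
  using window_subgroup[of 0 "int N"] by (auto simp: block_subgroups_def)

text \<open>Only finitely many traces on a block occur, so an arbitrary function of the trace is a
  finite combination of indicators of cylinders.\<close>

lemma block_integral:
  assumes \<mu>: "\<mu> \<in> IRS_star G"
  shows "(\<lambda>H. h (H \<inter> win 0 (int N))) \<in> borel_measurable \<mu>"
    and "(\<integral>H. h (H \<inter> win 0 (int N)) \<partial>\<mu>) = (\<Sum>X\<in>block_subgroups N. block_law \<mu> N X * h X)"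
proof -
  interpret prob_space \<mu> using \<mu> by (simp add: IRS_star_iff)
  have sets: "sets \<mu> = sets \<B>" and space: "space \<mu> = Sub G" using \<mu> by (auto simp: IRS_star_iff)
  define E where "E X = {H \<in> Sub G. H \<inter> win 0 (int N) = X}" for X
  have E: "E X \<in> sets \<mu>" if "X \<in> block_subgroups N" for X
  proof -
    have "win 0 (int N) \<subseteq> carrier G" using window_base base_carrier by blast
    from closedin_sub_topology_cylinder[OF carrier_nonempty finite_window this, of X]
    have "{H \<in> Sub G. H \<inter> win 0 (int N) = X \<inter> win 0 (int N)} \<in> sets \<mu>"
      unfolding sets by (rule closedin_borel_sets)
    moreover have "X \<inter> win 0 (int N) = X" using that by (auto simp: block_subgroups_def)
    ultimately show ?thesis by (simp add: E_def)
  qed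
  have eq: "h (H \<inter> win 0 (int N)) = (\<Sum>X\<in>block_subgroups N. h X * indicator (E X) H)" if "H \<in> space \<mu>" for H
  proof -
    have H: "H \<in> Sub G" using that space by simp
    then have mem: "H \<inter> win 0 (int N) \<in> block_subgroups N"
      using base_subgroups_Int_window by (simp add: block_subgroups_def)
    have "(\<Sum>X\<in>block_subgroups N. h X * indicator (E X) H) = (\<Sum>X\<in>block_subgroups N. if X = H \<inter> win 0 (int N) then h X else 0)"
      using H by (intro sum.cong) (auto simp: E_def)
    then show ?thesis using mem finite_block_subgroups by simp
  qed
  have "(\<lambda>H. \<Sum>X\<in>block_subgroups N. h X * indicator (E X) H) \<in> borel_measurable \<mu>"
    by (intro borel_measurable_sum borel_measurable_times borel_measurable_const borel_measurable_indicator E)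
  then show "(\<lambda>H. h (H \<inter> win 0 (int N))) \<in> borel_measurable \<mu>"
    by (subst measurable_cong[OF eq])
  have "(\<integral>H. h (H \<inter> win 0 (int N)) \<partial>\<mu>) = (\<integral>H. (\<Sum>X\<in>block_subgroups N. h X * indicator (E X) H) \<partial>\<mu>)"
    by (rule Bochner_Integration.integral_cong[OF refl eq])
  also have "\<dots> = (\<Sum>X\<in>block_subgroups N. \<integral>H. h X * indicator (E X) H \<partial>\<mu>)"
    by (intro Bochner_Integration.integral_sum integrable_mult_right integrable_real_indicator E)
       (simp_all add: emeasure_eq_measure)
  also have "\<dots> = (\<Sum>X\<in>block_subgroups N. block_law \<mu> N X * h X)"
    by (intro sum.cong refl) (use E in \<open>simp add: block_law_def E_def\<close>)
  finally show "(\<integral>H. h (H \<inter> win 0 (int N)) \<partial>\<mu>) = (\<Sum>X\<in>block_subgroups N. block_law \<mu> N X * h X)" .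
qed

lemma sum_block_law:
  assumes "\<mu> \<in> IRS_star G"
  shows "sum (block_law \<mu> N) (block_subgroups N) = 1"
proof -
  interpret prob_space \<mu> using assms by (simp add: IRS_star_iff)
  show ?thesis using block_integral(2)[OF assms, of "\<lambda>_. 1" N] by (simp add: prob_space)
qed

lemma continuous_bounded:
  assumes "continuous_map T euclideanreal f"
  obtains C where "\<And>H. H \<in> Sub G \<Longrightarrow> \<bar>f H\<bar> \<le> C"
proof -
  have "compactin T (Sub G)" using compact_space_sub_topology[OF group_G] by (simp add: compact_space_def)
  then have "compact (f ` Sub G)" using image_compactin[OF _ assms] by simp
  then have "bounded (f ` Sub G)" by (rule compact_imp_bounded)
  then show ?thesis using that unfolding bounded_iff by auto
qed

text \<open>For subgroups of the base only the part of the test set inside the base counts, and that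
  part fits into a window. Allowing all larger radii lets finitely many functions share one
  radius.\<close>

lemma window_approx:
  assumes "continuous_map T euclideanreal f" "e > 0"
  obtains R :: nat where "\<And>R' H. R \<le> R' \<Longrightarrow> H \<in> base_subgroups n p \<Longrightarrow> \<bar>f H - f (H \<inter> win (- int R') (int R' + 1))\<bar> \<le> e"
proof -
  obtain F where F: "finite F" "F \<subseteq> carrier G"
    "\<And>H H'. H \<in> Sub G \<Longrightarrow> H' \<in> Sub G \<Longrightarrow> H \<inter> F = H' \<inter> F \<Longrightarrow> \<bar>f H - f H'\<bar> < e"
    by (rule uniform_approx_sub_topology[OF group_G assms]) blast
  obtain m where m: "F \<inter> base \<subseteq> win (- int m) (int m)" using finite_subset_window[OF F(1)] .
  show ?thesis
  proof (rule that[of m])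
    fix R' :: nat and H assume R': "m \<le> R'" and H: "H \<in> base_subgroups n p"
    have "win (- int m) (int m) \<subseteq> win (- int R') (int R' + 1)" using R' by (auto intro: window_mono[rotated 2])
    then have "H \<inter> F = (H \<inter> win (- int R') (int R' + 1)) \<inter> F" using m base_subgroupsD(1)[OF H] by blast
    then show "\<bar>f H - f (H \<inter> win (- int R') (int R' + 1))\<bar> \<le> e"
      using F(3)[OF base_subgroups_Sub[OF H] subgroup_Int_window[OF base_subgroups_Sub[OF H]]] by (simp add: less_imp_le)
  qed
qed

lemma integrable_continuous:
  assumes \<mu>: "\<mu> \<in> IRS_star G" and f: "continuous_map T euclideanreal f"
  shows "integrable \<mu> f"
proof -
  interpret prob_space \<mu> using \<mu> by (simp add: IRS_star_iff)
  obtain C where C: "\<And>H. H \<in> Sub G \<Longrightarrow> \<bar>f H\<bar> \<le> C" by (rule continuous_bounded[OF f]) blast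
  have sets: "sets \<mu> = sets \<B>" using \<mu> by (simp add: IRS_star_iff)
  have "f \<in> borel_measurable \<mu>"
    using continuous_map_borel_measurable[OF f] measurable_cong_sets[OF sets refl] by blast
  then show ?thesis by (intro integrable_const_bound[where B = C]) (use C \<mu> in \<open>auto simp: IRS_star_iff\<close>)
qed

text \<open>Here the invariance of \<mu> enters the approximation: at every offset \<open>r\<close>
  away from the ends of the block, the block law gives the same mean as the window at the
  origin.\<close>

lemma block_average:
  assumes \<mu>: "\<mu> \<in> IRS_star G" and f: "continuous_map T euclideanreal f" and r: "R \<le> r" "r + R < N"
  shows "(\<Sum>X\<in>block_subgroups N. block_law \<mu> N X * f (translate (- int r) ` X \<inter> win (- int R) (int R + 1)))
    = (\<integral>H. f (H \<inter> win (- int R) (int R + 1)) \<partial>\<mu>)"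
proof -
  let ?W = "win (- int R) (int R + 1)"
  let ?h = "\<lambda>X. f (translate (- int r) ` X \<inter> ?W)"
  let ?g = "shifter (- int r)"
  have sets: "sets \<mu> = sets \<B>" using \<mu> by (simp add: IRS_star_iff)
  have cf: "(\<lambda>H. f (H \<inter> ?W)) \<in> borel_measurable \<B>"
    using continuous_map_compose[OF continuous_map_Int_window f] by (intro continuous_map_borel_measurable) (simp add: o_def)
  have m: "(\<lambda>H. f (conjug G ?g H \<inter> ?W)) \<in> borel_measurable \<mu>"
    using measurable_compose[OF conjug_measurable[OF shifter_carrier] cf] measurable_cong_sets[OF sets refl] by blast
  have pt: "?h (H \<inter> win 0 (int N)) = f (conjug G ?g H \<inter> ?W)" if H: "H \<in> base_subgroups n p" for H
  proof -
    have "x \<in> translate (- int r) ` (H \<inter> win 0 (int N)) \<longleftrightarrow> x \<in> translate (- int r) ` H" if x: "x \<in> ?W" for x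
    proof -
      have "translate (int r) x \<in> win 0 (int N)"
        unfolding translate_window by (rule window_mono[OF _ _ x]) (use r in linarith)+
      then show ?thesis by (simp add: mem_translate_iff del: translate_window)
    qed
    then have "translate (- int r) ` (H \<inter> win 0 (int N)) \<inter> ?W = translate (- int r) ` H \<inter> ?W" by blast
    then show ?thesis using H by (simp add: conjug_base_subgroup)
  qed
  have "(\<Sum>X\<in>block_subgroups N. block_law \<mu> N X * ?h X) = (\<integral>H. ?h (H \<inter> win 0 (int N)) \<partial>\<mu>)"
    by (rule block_integral(2)[OF \<mu>, symmetric])
  \<comment> \<open>Conjugation is identified with translation only on
    \<open>base_subgroups\<close>, a set of full measure, hence the equality almost
    everywhere.\<close>
  also have "\<dots> = (\<integral>H. f (conjug G ?g H \<inter> ?W) \<partial>\<mu>)"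
    by (rule integral_cong_AE[OF block_integral(1)[OF \<mu>, of ?h N] m]) (use AE_base_subgroups[OF \<mu>] pt in auto)
  also have "\<dots> = (\<integral>H. f (H \<inter> ?W) \<partial>\<mu>)"
    by (rule integral_conjug[OF \<mu> shifter_carrier cf])
  finally show ?thesis .
qed

text \<open>The error 4e has four sources of size e: cutting \<open>f\<close> to the window for the
  periodic subgroup; replacing block frequencies by the block law, where each of the
  \<open>card (block_subgroups N)\<close> terms pairs the tolerance in the hypothesis with a value
  of size at most C; cutting \<open>f\<close> to the window under \<mu>; and the 2R bad offsets,
  each off by at most 2C, which contribute 4CR/N.\<close>

lemma orbit_measure_approx:
  fixes C e :: real and R N :: nat
  assumes \<mu>: "\<mu> \<in> IRS_star G" and f: "continuous_map T euclideanreal f"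
    and C: "C > 0" "\<And>H. H \<in> Sub G \<Longrightarrow> \<bar>f H\<bar> \<le> C" and e: "e > 0"
    and R: "\<And>H. H \<in> base_subgroups n p \<Longrightarrow> \<bar>f H - f (H \<inter> win (- int R) (int R + 1))\<bar> \<le> e"
    and N: "N > 0" "4 * C * R \<le> e * N"
    and xs: "xs \<noteq> []" "set xs \<subseteq> block_subgroups N"
      "\<And>X. X \<in> block_subgroups N \<Longrightarrow> \<bar>count_list xs X / length xs - block_law \<mu> N X\<bar> \<le> e / (C * card (block_subgroups N))"
  defines "Z \<equiv> periodic_concat N (\<lambda>j. xs ! nat (j mod int (length xs)))"
  shows "orbit_measure (length xs * N) Z \<in> extreme_measures (IRS_star G)"
    and "\<bar>integral\<^sup>L (orbit_measure (length xs * N) Z) f - integral\<^sup>L \<mu> f\<bar> \<le> 4 * e"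
proof -
  interpret prob_space \<mu> using \<mu> by (simp add: IRS_star_iff)
  define K where "K = length xs"
  have K: "K > 0" using xs(1) by (simp add: K_def)
  let ?W = "win (- int R) (int R + 1)"
  let ?P = "block_subgroups N"
  define Y where "Y j = xs ! nat (j mod int K)" for j
  have Y: "Y j \<in> base_subgroups n p" for j
  proof -
    have "nat (j mod int K) < length xs" using K by (simp add: K_def nat_less_iff)
    then have "Y j \<in> set xs" unfolding Y_def by (rule nth_mem)
    then show ?thesis using xs(2) by (auto simp: block_subgroups_def)
  qed
  have Zdef: "Z = periodic_concat N Y" by (simp add: Z_def Y_def[abs_def] K_def)
  have Z: "Z \<in> base_subgroups n p" unfolding Zdef by (rule periodic_concat_subgroup[OF Y])
  have per: "translate (int (K * N)) ` Z = Z" unfolding Zdef by (rule periodic_concat_periodic) (simp add: Y_def)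
  have KN: "K * N > 0" using K N by simp
  show "orbit_measure (length xs * N) Z \<in> extreme_measures (IRS_star G)"
    using orbit_measure_extreme[OF KN Z per] by (simp add: K_def)
  define I where "I = integral\<^sup>L \<mu> f"
  define J where "J = (\<integral>H. f (H \<inter> ?W) \<partial>\<mu>)"
  have cont: "continuous_map T euclideanreal (\<lambda>H. f (H \<inter> ?W))"
    using continuous_map_compose[OF continuous_map_Int_window f] by (simp add: o_def)
  have intf: "integrable \<mu> f" by (rule integrable_continuous[OF \<mu> f])
  have intg: "integrable \<mu> (\<lambda>H. f (H \<inter> ?W))" by (rule integrable_continuous[OF \<mu> cont])
  have AEd: "AE H in \<mu>. \<bar>f H - f (H \<inter> ?W)\<bar> \<le> e" using AE_base_subgroups[OF \<mu>] R by auto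
  have "(\<integral>H. f H - f (H \<inter> ?W) \<partial>\<mu>) \<le> e"
    by (rule integral_le_const) (use intf intg AEd in \<open>auto simp: abs_le_iff\<close>)
  moreover have "(\<integral>H. f H - f (H \<inter> ?W) \<partial>\<mu>) \<ge> - e"
    by (rule integral_ge_const) (use intf intg AEd in \<open>auto simp: abs_le_iff\<close>)
  ultimately have IJ: "\<bar>I - J\<bar> \<le> e" using intf intg by (simp add: I_def J_def)
  have fI: "\<bar>I\<bar> \<le> C"
  proof -
    have "AE H in \<mu>. \<bar>f H\<bar> \<le> C" using AE_base_subgroups[OF \<mu>] C(2) base_subgroups_Sub by auto
    then have "I \<le> C" "- C \<le> I" unfolding I_def
      by (auto intro!: integral_le_const integral_ge_const intf simp: abs_le_iff)
    then show ?thesis by simp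
  qed
  define D where "D r = (\<Sum>j<K. f (translate (- (int j * int N + int r)) ` Z)) / K" for r
  \<comment> \<open>Shared by the next two bounds: the comparison values \<open>y j\<close> are
    constant for \<open>bad\<close> and depend on the block for \<open>good\<close>.\<close>
  have av: "\<bar>D r - x\<bar> \<le> a" if "\<And>j. j < K \<Longrightarrow> \<bar>f (translate (- (int j * int N + int r)) ` Z) - y j\<bar> \<le> a" "x = (\<Sum>j<K. y j) / K" for r x y a
  proof -
    have "\<bar>D r - x\<bar> = \<bar>\<Sum>j<K. f (translate (- (int j * int N + int r)) ` Z) - y j\<bar> / K"
      by (simp add: D_def that(2) sum_subtractf abs_divide flip: diff_divide_distrib)
    also have "\<dots> \<le> (\<Sum>j<K. a) / K"
      by (intro divide_right_mono order.trans[OF sum_abs] sum_mono) (use that(1) in auto)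
    finally show ?thesis using K by simp
  qed
  have tZ: "translate s ` Z \<in> base_subgroups n p" for s by (rule base_subgroups_translate[OF Z])
  have bad: "\<bar>D r - I\<bar> \<le> 2 * C" for r
  proof (rule av)
    show "I = (\<Sum>j<K. I) / K" using K by simp
    fix j
    show "\<bar>f (translate (- (int j * int N + int r)) ` Z) - I\<bar> \<le> 2 * C"
      using C(2)[OF base_subgroups_Sub[OF tZ], of "- (int j * int N + int r)"] fI by linarith
  qed
  have good: "\<bar>D r - I\<bar> \<le> 3 * e" if r: "R \<le> r" "r + R < N" for r
  proof -
    define h where "h X = f (translate (- int r) ` X \<inter> ?W)" for X
    have "\<bar>D r - (\<Sum>j<K. h (Y (int j))) / K\<bar> \<le> e"
    proof (rule av[OF _ refl])
      fix j
      have "translate (- (int j * int N + int r)) ` Z \<inter> ?W = translate (- int r) ` Y (int j) \<inter> ?W"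
        unfolding Zdef by (rule periodic_concat_window[OF Y r])
      then show "\<bar>f (translate (- (int j * int N + int r)) ` Z) - h (Y (int j))\<bar> \<le> e"
        using R[OF tZ, of "- (int j * int N + int r)"] by (simp add: h_def)
    qed
    moreover have "(\<Sum>j<K. h (Y (int j))) = (\<Sum>X\<in>?P. count_list xs X * h X)"
    proof -
      have "(\<Sum>j<K. h (Y (int j))) = (\<Sum>j<length xs. h (xs ! j))"
        unfolding K_def[symmetric] by (rule sum.cong) (simp_all add: Y_def)
      also have "\<dots> = (\<Sum>X\<in>?P. count_list xs X * h X)"
        by (rule sum_nth_eq_sum_count[OF finite_block_subgroups xs(2)])
      finally show ?thesis .
    qed
    moreover have "\<bar>(\<Sum>X\<in>?P. count_list xs X * h X) / K - J\<bar> \<le> e"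
    proof -
      have J: "J = (\<Sum>X\<in>?P. block_law \<mu> N X * h X)"
        unfolding J_def h_def by (rule block_average[OF \<mu> f r, symmetric])
      have "\<bar>(\<Sum>X\<in>?P. count_list xs X * h X) / K - J\<bar> = \<bar>\<Sum>X\<in>?P. (count_list xs X / K - block_law \<mu> N X) * h X\<bar>"
        by (simp add: J sum_divide_distrib sum_subtractf left_diff_distrib)
      also have "\<dots> \<le> (\<Sum>X\<in>?P. e / (C * card ?P) * C)"
      proof (intro order.trans[OF sum_abs] sum_mono)
        fix X assume X: "X \<in> ?P"
        have "translate (- int r) ` X \<in> base_subgroups n p"
          using X by (intro base_subgroups_translate) (simp add: block_subgroups_def)
        then have "\<bar>h X\<bar> \<le> C" unfolding h_def by (intro C(2) subgroup_Int_window base_subgroups_Sub)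
        then show "\<bar>(count_list xs X / K - block_law \<mu> N X) * h X\<bar> \<le> e / (C * card ?P) * C"
          unfolding abs_mult using xs(3)[OF X] C(1) e by (intro mult_mono) (auto simp: K_def)
      qed
      also have "\<dots> = e" using C(1) block_subgroups_nonempty[of N] finite_block_subgroups[of N] by (simp add: card_gt_0_iff)
      finally show ?thesis .
    qed
    ultimately show ?thesis using IJ by (simp only: abs_le_iff) linarith
  qed
  have meas: "f \<in> borel_measurable \<B>" by (rule continuous_map_borel_measurable[OF f])
  have "integral\<^sup>L (orbit_measure (K * N) Z) f = (\<Sum>s\<in>{0..<int (K * N)}. f (translate (- s) ` Z)) / (K * N)"
    using integral_orbit_measure[OF KN Z per meas] by simp
  also have "\<dots> = (\<Sum>r<N. D r) / N"
    unfolding sum_int_blocks[of "\<lambda>s. f (translate (- s) ` Z)"] by (simp add: D_def sum_divide_distrib[symmetric])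
  finally have int_eq: "integral\<^sup>L (orbit_measure (K * N) Z) f = (\<Sum>r<N. D r) / N" .
  have "\<bar>(\<Sum>r<N. D r) / N - I\<bar> \<le> 3 * e + (2 * C) * (2 * real R) / N"
    by (rule average_mostly_close) (use good bad C(1) e N in auto)
  also have "(2 * C) * (2 * real R) / N \<le> e" using N by (simp add: field_simps)
  finally show "\<bar>integral\<^sup>L (orbit_measure (length xs * N) Z) f - integral\<^sup>L \<mu> f\<bar> \<le> 4 * e"
    using int_eq by (simp add: I_def K_def)
qed

text \<open>One measure has to serve all of \<open>\<F>\<close>, so the bound, the radius and the
  block length are chosen in common.\<close>

lemma extreme_dense:
  assumes \<mu>: "\<mu> \<in> IRS_star G" and \<F>: "finite \<F>" "\<And>f. f \<in> \<F> \<Longrightarrow> continuous_map T euclideanreal f" and e: "e > 0"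
  shows "\<exists>\<nu>\<in>extreme_measures (IRS_star G). \<forall>f\<in>\<F>. \<bar>integral\<^sup>L \<nu> f - integral\<^sup>L \<mu> f\<bar> < e"
proof -
  \<comment> \<open>A fifth of e keeps the error 4d strictly below e.\<close>
  define d where "d = e / 5"
  have d: "d > 0" using e by (simp add: d_def)
  have "\<exists>C. \<forall>H\<in>Sub G. \<bar>f H\<bar> \<le> C" if "f \<in> \<F>" for f
    using continuous_bounded[OF \<F>(2)[OF that]] by metis
  then obtain c where c: "\<And>f H. f \<in> \<F> \<Longrightarrow> H \<in> Sub G \<Longrightarrow> \<bar>f H\<bar> \<le> c f" by metis
  have "\<exists>R::nat. \<forall>R'\<ge>R. \<forall>H\<in>base_subgroups n p. \<bar>f H - f (H \<inter> win (- int R') (int R' + 1))\<bar> \<le> d" if "f \<in> \<F>" for f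
    using window_approx[OF \<F>(2)[OF that] d] by metis
  then obtain \<rho> :: "_ \<Rightarrow> nat" where \<rho>: "\<And>f R' H. f \<in> \<F> \<Longrightarrow> \<rho> f \<le> R' \<Longrightarrow> H \<in> base_subgroups n p \<Longrightarrow>
      \<bar>f H - f (H \<inter> win (- int R') (int R' + 1))\<bar> \<le> d" by metis
  \<comment> \<open>Sums replace maxima: they dominate each summand and make sense for empty
    \<open>\<F>\<close>. The summand 1 keeps \<open>C\<close> positive.\<close>
  define C where "C = 1 + (\<Sum>f\<in>\<F>. \<bar>c f\<bar>)"
  define R where "R = sum \<rho> \<F>"
  have C: "C > 0" unfolding C_def by (intro add_pos_nonneg sum_nonneg) simp_all
  have Cf: "\<bar>f H\<bar> \<le> C" if "f \<in> \<F>" "H \<in> Sub G" for f H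
  proof -
    have "\<bar>c f\<bar> \<le> (\<Sum>f\<in>\<F>. \<bar>c f\<bar>)" by (rule member_le_sum) (use that \<F>(1) in auto)
    then show ?thesis using c[OF that] by (simp add: C_def)
  qed
  have Rf: "\<rho> f \<le> R" if "f \<in> \<F>" for f
    unfolding R_def by (rule member_le_sum) (use that \<F>(1) in auto)
  obtain N :: nat where "N > 4 * C * R / d" using reals_Archimedean2 by blast
  moreover have "4 * C * R / d \<ge> 0" using C d by simp
  ultimately have "real N > 0" "4 * C * R < d * N" using d by (linarith, simp add: pos_divide_less_eq mult.commute)
  then have N: "N > 0" "4 * C * R \<le> d * N" by simp_all
  have "d / (C * card (block_subgroups N)) > 0"
    using C d block_subgroups_nonempty[of N] finite_block_subgroups[of N] by (simp add: card_gt_0_iff)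
  moreover have "block_law \<mu> N X \<ge> 0" for X by (simp add: block_law_def)
  ultimately obtain xs where xs: "xs \<noteq> []" "set xs \<subseteq> block_subgroups N"
    "\<And>X. X \<in> block_subgroups N \<Longrightarrow> \<bar>count_list xs X / length xs - block_law \<mu> N X\<bar> \<le> d / (C * card (block_subgroups N))"
    using rational_weights[OF finite_block_subgroups block_subgroups_nonempty _ sum_block_law[OF \<mu>]] by metis
  define \<nu> where "\<nu> = orbit_measure (length xs * N) (periodic_concat N (\<lambda>j. xs ! nat (j mod int (length xs))))"
  have approx: "\<nu> \<in> extreme_measures (IRS_star G)" "\<bar>integral\<^sup>L \<nu> f - integral\<^sup>L \<mu> f\<bar> \<le> 4 * d"
    if f: "continuous_map T euclideanreal f" "\<And>H. H \<in> Sub G \<Longrightarrow> \<bar>f H\<bar> \<le> C"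
      "\<And>H. H \<in> base_subgroups n p \<Longrightarrow> \<bar>f H - f (H \<inter> win (- int R) (int R + 1))\<bar> \<le> d" for f
    using orbit_measure_approx[OF \<mu> f(1) C f(2) d f(3) N xs] by (simp_all add: \<nu>_def)
  \<comment> \<open>Extremality is read off from the zero function, since \<open>\<F>\<close> may be
    empty.\<close>
  have "\<nu> \<in> extreme_measures (IRS_star G)" by (rule approx(1)[of "\<lambda>_. 0"]) (use C d in auto)
  moreover have "\<bar>integral\<^sup>L \<nu> f - integral\<^sup>L \<mu> f\<bar> < e" if "f \<in> \<F>" for f
  proof -
    have "\<bar>integral\<^sup>L \<nu> f - integral\<^sup>L \<mu> f\<bar> \<le> 4 * d"
      by (rule approx(2)) (use \<F>(2)[OF that] Cf[OF that] \<rho>[OF that Rf[OF that]] in auto)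
    then show ?thesis using e by (simp add: d_def)
  qed
  ultimately show ?thesis by blast
qed

end

theorem theorem1p2:
  fixes p n :: nat
  assumes "prime p" and "n \<ge> 1"
  shows "poulsen (weak_star_topology (sub_topology (lamp_group n p)) (IRS_star (lamp_group n p)))
                 (IRS_star (lamp_group n p))"
proof -
  interpret lamplighter n p
    using assms by unfold_locales (auto dest: prime_ge_2_nat)
  let ?S = "IRS_star G"
  let ?W = "weak_star_topology T ?S"
  have sub: "extreme_measures ?S \<subseteq> ?S" by (auto simp: extreme_measures_def)
  have "topspace ?W \<subseteq> ?S" by (simp add: weak_star_topology_def)
  moreover have "?S \<subseteq> ?W closure_of extreme_measures ?S"
  proof
    fix \<mu> assume "\<mu> \<in> ?S"
    then show "\<mu> \<in> ?W closure_of extreme_measures ?S"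
      by (rule in_weak_star_closure[OF _ sub]) (rule extreme_dense[OF \<open>\<mu> \<in> ?S\<close>])
  qed
  ultimately show ?thesis
    unfolding poulsen_def by (meson closure_of_subset_topspace subset_antisym subset_trans)
qed

end
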